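(* Let $\mathbb{F}$ be a field. Up to isomorphism there is a unique nilpotent symplectic alternating algebra $L$ over $\mathbb{F}$ of dimension $10$ with an isotropic center $Z(L)$ of dimension $4$ such that $L^{3}=Z(L)$ and $L$ is of type B. This algebra can be given by the presentation $$\mathcal{P}_{10}^{(4,3)}:\ (x_{1}y_{2},y_{3})=1,\ (y_{1}y_{2},y_{4})=1,\ (y_{1}y_{3},y_{5})=1.$$
   Context: A symplectic alternating algebra (SAA) over a field $\mathbb{F}$ is a finite-dimensional $\mathbb{F}$-vector space $L$ with a non-degenerate alternating bilinear form $(\cdot,\cdot)$ and a bilinear alternating product $L\times L\to L$, $(x,y)\mapsto xy$ (so $xx=0$), such that $(xy,z)=(yz,x)$ for all $x,y,z\in L$. Consequently $(u,v,w)\mapsto (uv,w)$ is an alternating trilinear form, and by non-degeneracy it determines the product. An isomorphism of SAAs is a linear bijection preserving both the product and the form. For subspaces $U,V\le L$, $UV$ denotes the linear span of all products $uv$ with $u\in U$, $v\in V$. Put $L^{1}=L$, $L^{k+1}=L^{k}L$; $L$ is nilpotent if $L^{k+1}=0$ for some $k$. The center is $Z(L)=\{z\in L: zx=0 \text{ for all } x\in L\}$. A subspace $U$ is isotropic if $(u,v)=0$ for all $u,v\in U$. A standard basis of a $10$-dimensional $L$ is a basis $x_{1},y_{1},\ldots,x_{5},y_{5}$ with $(x_i,x_j)=(y_i,y_j)=0$ and $(x_i,y_j)=\delta_{ij}$. A nilpotent presentation lists values of the triples $(x_iy_j,y_k)$ and $(y_iy_j,y_k)$ with $1\le i<j<k\le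 5$ with respect to a standard basis. By convention, all triple values $(uv,w)$ of basis vectors $u,v,w$ which do not follow from the listed ones by the alternating property are $0$. Such a presentation determines an SAA up to isomorphism. Let $L$ be a nilpotent SAA of dimension $10$ with isotropic center of dimension $4$ and $L^{3}=Z(L)$. Then $L^{2}/Z(L)$ is $2$-dimensional, $L/L^{2}$ is $4$-dimensional and $L^2$ is abelian. For $\bar z=z+Z(L)\in L^{2}/Z(L)$ one has the well-defined alternating form $\phi_{\bar z}:L/L^{2}\times L/L^{2}\to\mathbb{F}$, $\phi_{\bar z}(u+L^{2},v+L^{2})=(zu,v)$. $L$ is of type B if there is $0\neq\bar z\in L^{2}/Z(L)$ such that $\phi_{\bar z}$ is degenerate but $\phi_{\bar t}$ is non-degenerate for all $\bar t\in L^{2}/Z(L)$ not in $\mathbb{F}\bar z$. *)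

theory Defs
  imports "HOL-Analysis.Cartesian_Space" "HOL-Library.Numeral_Type"
begin

text \<open>The underlying vector space is the whole type \<open>'v\<close>, over an arbitrary field \<open>'f\<close>
  (of any characteristic, finite or infinite).\<close>

locale symplectic_alternating_algebra = vector_space smul
  for smul :: "'f::field \<Rightarrow> 'v::ab_group_add \<Rightarrow> 'v" +
  fixes form :: "'v \<Rightarrow> 'v \<Rightarrow> 'f"
    and mul :: "'v \<Rightarrow> 'v \<Rightarrow> 'v"  (infixl \<open>\<cdot>\<close> 70)
  assumes finite_dim: "\<exists>B. finite B \<and> span B = UNIV"
    and form_linear_left: "Vector_Spaces.linear smul (*) (\<lambda>x. form x y)"
    and form_linear_right: "Vector_Spaces.linear smul (*) (\<lambda>y. form x y)"
    and form_alternating: "form x x = 0"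
    and form_nondegenerate: "(\<forall>y. form x y = 0) \<Longrightarrow> x = 0"
    and mul_linear_left: "Vector_Spaces.linear smul smul (\<lambda>x. x \<cdot> y)"
    and mul_linear_right: "Vector_Spaces.linear smul smul (\<lambda>y. x \<cdot> y)"
    and mul_alternating: "x \<cdot> x = 0"
    and form_mul_cyclic: "form (x \<cdot> y) z = form (y \<cdot> z) x"
begin

definition mul_span :: "'v set \<Rightarrow> 'v set \<Rightarrow> 'v set"
  where "mul_span U V = span {u \<cdot> v | u v. u \<in> U \<and> v \<in> V}"

text \<open>\<open>lower k\<close> is $L^k$ for \<open>k \<ge> 1\<close>; the value at \<open>0\<close> is junk (set to $L$).\<close>

primrec lower :: "nat \<Rightarrow> 'v set" where
  "lower 0 = UNIV"
| "lower (Suc k) = (if k = 0 then UNIV else mul_span (lower k) UNIV)"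

definition nilpotent :: bool
  where "nilpotent \<longleftrightarrow> (\<exists>k. lower (k + 1) = {0})"

definition center :: "'v set"
  where "center = {z. \<forall>x. z \<cdot> x = 0}"

definition isotropic :: "'v set \<Rightarrow> bool"
  where "isotropic U \<longleftrightarrow> (\<forall>u\<in>U. \<forall>v\<in>U. form u v = 0)"

text \<open>The form $\phi_{\bar z}$ on $L/L^2$, written on representatives; it does not depend on
  their choice by \<open>phi_well_defined\<close> below.\<close>

definition phi :: "'v \<Rightarrow> 'v \<Rightarrow> 'v \<Rightarrow> 'f"
  where "phi z u v = form (z \<cdot> u) v"

text \<open>Degeneracy of the alternating form on the quotient by \<open>W\<close> induced by \<open>b\<close>: some nonzero
  class \<open>u + W\<close> is orthogonal to all classes.\<close>

definition degenerate_mod :: "'v set \<Rightarrow> ('v \<Rightarrow> 'v \<Rightarrow> 'f) \<Rightarrow> bool"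
  where "degenerate_mod W b \<longleftrightarrow> (\<exists>u. u \<notin> W \<and> (\<forall>v. b u v = 0))"

text \<open>Classes in $L^2/Z(L)$ are given by representatives \<open>z\<close>, \<open>t\<close> in $L^2$: \<open>z \<notin> center\<close> says
  $\bar z \neq 0$, and \<open>\<forall>c. t - smul c z \<notin> center\<close> says $\bar t \notin F \bar z$.\<close>

definition type_B :: bool
  where "type_B \<longleftrightarrow>
    (\<exists>z\<in>lower 2. z \<notin> center \<and> degenerate_mod (lower 2) (phi z) \<and>
      (\<forall>t\<in>lower 2. (\<forall>c. t - smul c z \<notin> center) \<longrightarrow> \<not> degenerate_mod (lower 2) (phi t)))"

end

text \<open>\<open>X i\<close> and \<open>Y i\<close> are the labels of the standard basis vectors $x_i$ and $y_i$.\<close>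

datatype basis_index = X nat | Y nat

definition basis_indices :: "nat \<Rightarrow> basis_index set"
  where "basis_indices n = X ` {1..n} \<union> Y ` {1..n}"

text \<open>The entry \<open>((p, q, r), c)\<close> stands for $(b_p b_q, b_r) = c$.\<close>

type_synonym 'f presentation = "((basis_index \<times> basis_index \<times> basis_index) \<times> 'f) list"

context symplectic_alternating_algebra
begin

definition standard_basis :: "nat \<Rightarrow> (basis_index \<Rightarrow> 'v) \<Rightarrow> bool"
  where "standard_basis n b \<longleftrightarrow>
    inj_on b (basis_indices n) \<and> independent (b ` basis_indices n) \<and>
    span (b ` basis_indices n) = UNIV \<and>
    (\<forall>i\<in>{1..n}. \<forall>j\<in>{1..n}.
      form (b (X i)) (b (X j)) = 0 \<and> form (b (Y i)) (b (Y j)) = 0 \<and>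
      form (b (X i)) (b (Y j)) = (if i = j then 1 else 0))"

text \<open>The last conjunct is the convention on unlisted triples. A triple value follows from the
  listed ones by the alternating property iff two of its entries coincide (and then it is
  \<open>0\<close> anyway) or it is a permutation of a listed triple. The entries of a listed triple
  are pairwise distinct, so permutations can be recognised by comparing the sets of entries.\<close>

definition has_presentation :: "nat \<Rightarrow> 'f presentation \<Rightarrow> (basis_index \<Rightarrow> 'v) \<Rightarrow> bool"
  where "has_presentation n P b \<longleftrightarrow>
    standard_basis n b \<and>
    (\<forall>((p, q, r), c)\<in>set P. form (b p \<cdot> b q) (b r) = c) \<and>
    (\<forall>p\<in>basis_indices n. \<forall>q\<in>basis_indices n. \<forall>r\<in>basis_indices n.
      (\<forall>((p', q', r'), c)\<in>set P. {p, q, r} \<noteq> {p', q', r'}) \<longrightarrow> form (b p \<cdot> b q) (b r) = 0)"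

lemma form_simps:
  "form (x + x') y = form x y + form x' y" "form x (y + y') = form x y + form x y'"
  "form (smul c x) y = c * form x y" "form x (smul c y) = c * form x y"
  "form 0 y = 0" "form x 0 = 0"
proof -
  interpret l: Vector_Spaces.linear smul "(*)" "\<lambda>x. form x y" for y
    by (rule form_linear_left)
  interpret r: Vector_Spaces.linear smul "(*)" "\<lambda>y. form x y" for x
    by (rule form_linear_right)
  show "form (x + x') y = form x y + form x' y" "form x (y + y') = form x y + form x y'"
    "form (smul c x) y = c * form x y" "form x (smul c y) = c * form x y"
    "form 0 y = 0" "form x 0 = 0"
    by (simp_all add: l.add l.scale l.zero r.add r.scale r.zero)
qed

lemma mul_add: "(x + x') \<cdot> y = x \<cdot> y + x' \<cdot> y" "x \<cdot> (y + y') = x \<cdot> y + x \<cdot> y'"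
proof -
  interpret l: Vector_Spaces.linear smul smul "\<lambda>x. x \<cdot> y" for y
    by (rule mul_linear_left)
  interpret r: Vector_Spaces.linear smul smul "\<lambda>y. x \<cdot> y" for x
    by (rule mul_linear_right)
  show "(x + x') \<cdot> y = x \<cdot> y + x' \<cdot> y" "x \<cdot> (y + y') = x \<cdot> y + x \<cdot> y'"
    by (simp_all add: l.add r.add)
qed

lemma lower_2: "lower 2 = span {u \<cdot> v | u v. True}"
  by (simp add: numeral_2_eq_2 mul_span_def)

lemma lower_3: "lower 3 = span {u \<cdot> v | u v. u \<in> lower 2}"
  by (simp add: numeral_3_eq_3 numeral_2_eq_2 mul_span_def)

lemma form_center_lower_2:
  assumes "z \<in> center" "u \<in> lower 2"
  shows "form z u = 0" "form u z = 0"
proof -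
  have z: "z \<cdot> x = 0" for x
    using assms(1) by (simp add: center_def)
  have "form u z = 0"
    using assms(2) unfolding lower_2
  proof (induction rule: span_induct_alt)
    case base
    show ?case by (simp add: form_simps)
  next
    case (step c x y)
    then obtain v w where "x = v \<cdot> w" by blast
    moreover have "form (v \<cdot> w) z = form (z \<cdot> v) w"
      using form_mul_cyclic by metis
    ultimately show ?case
      using step by (simp add: form_simps z)
  qed
  moreover have "form z u + form u z = 0"
    using form_alternating[of "z + u"] form_alternating[of z] form_alternating[of u]
    by (simp add: form_simps add.commute)
  ultimately show "form u z = 0" "form z u = 0"
    by simp_all
qed

lemma phi_well_defined:
  assumes "lower 3 = center" "z \<in> lower 2" "c \<in> center" "a \<in> lower 2" "b \<in> lower 2"
  shows "phi (z + c) (u + a) (v + b) = phi z u v"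
proof -
  have c: "c \<cdot> x = 0" for x
    using assms(3) by (simp add: center_def)
  have z: "z \<cdot> x \<in> center" for x
    using assms(2) unfolding assms(1)[symmetric] lower_3 by (blast intro: span_base)
  have za: "form (z \<cdot> a) w = 0" for w
  proof -
    have "form (z \<cdot> a) w = form (w \<cdot> z) a"
      using form_mul_cyclic by metis
    moreover have "w \<cdot> z = - (z \<cdot> w)"
      using mul_alternating[of "w + z"] mul_alternating[of w] mul_alternating[of z]
      by (simp add: mul_add eq_neg_iff_add_eq_0 add.commute)
    moreover have "- (z \<cdot> w) \<in> center"
      using z[of w] unfolding assms(1)[symmetric] lower_3 by (rule span_neg)
    ultimately show ?thesis
      using form_center_lower_2(1)[OF _ assms(4)] by simp
  qed
  show ?thesis
    unfolding phi_def using form_center_lower_2(1)[OF z assms(5)]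
    by (simp add: mul_add form_simps c za)
qed

end

definition type_B_algebra_10_4_3 ::
    "('f::field \<Rightarrow> 'v::ab_group_add \<Rightarrow> 'v) \<Rightarrow> ('v \<Rightarrow> 'v \<Rightarrow> 'f) \<Rightarrow> ('v \<Rightarrow> 'v \<Rightarrow> 'v) \<Rightarrow> bool"
  where "type_B_algebra_10_4_3 smul form mul \<longleftrightarrow>
    symplectic_alternating_algebra smul form mul \<and>
    symplectic_alternating_algebra.nilpotent smul mul \<and>
    vector_space.dim smul (UNIV :: 'v set) = 10 \<and>
    symplectic_alternating_algebra.isotropic form (symplectic_alternating_algebra.center mul) \<and>
    vector_space.dim smul (symplectic_alternating_algebra.center mul) = 4 \<and>
    symplectic_alternating_algebra.lower smul mul 3 = symplectic_alternating_algebra.center mul \<and>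
    symplectic_alternating_algebra.type_B smul form mul"

definition saa_isomorphic ::
    "('f::field \<Rightarrow> 'v::ab_group_add \<Rightarrow> 'v) \<Rightarrow> ('v \<Rightarrow> 'v \<Rightarrow> 'f) \<Rightarrow> ('v \<Rightarrow> 'v \<Rightarrow> 'v) \<Rightarrow>
     ('f \<Rightarrow> 'w::ab_group_add \<Rightarrow> 'w) \<Rightarrow> ('w \<Rightarrow> 'w \<Rightarrow> 'f) \<Rightarrow> ('w \<Rightarrow> 'w \<Rightarrow> 'w) \<Rightarrow> bool"
  where "saa_isomorphic smul form mul smul' form' mul' \<longleftrightarrow>
    (\<exists>f. Vector_Spaces.linear smul smul' f \<and> bij f \<and>
      (\<forall>x y. f (mul x y) = mul' (f x) (f y)) \<and>
      (\<forall>x y. form' (f x) (f y) = form x y))"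

definition P_10_4_3 :: "'f::field presentation"
  where "P_10_4_3 =
    [((X 1, Y 2, Y 3), 1), ((Y 1, Y 2, Y 4), 1), ((Y 1, Y 3, Y 5), 1)]"

end

theory Submission
  imports Defs
begin

text \<open>
  With $\phi(u,v,w) = (uv,w)$, choose $x_1$ with $\bar z = \bar x_1$ and $y_1 \in L^2$ with
  $(x_1,y_1) = 1$. The form $\phi(x_1,\cdot,\cdot)$ has rank 2 on the 4-dimensional $L/L^2$.
  The Pfaffian of $\phi(y_1 + k x_1,\cdot,\cdot)$ is affine in $k$ and its leading
  coefficient is the value of $\phi(y_1,\cdot,\cdot)$ on the radical of
  $\phi(x_1,\cdot,\cdot)$; as it never vanishes, this radical is isotropic for
  $\phi(y_1,\cdot,\cdot)$. This yields $y_2,\ldots,y_5$ on which both forms are in normal form;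
  adding multiples of $y_1$ to them kills all $\phi(y_i,y_j,y_k)$ with $i,j,k \ge 2$.
  The remaining $x_i$ are the central elements $\pm y_1 y_j$, and adding central elements, which
  does not affect $\phi$, turns everything into a standard basis.
\<close>

text \<open>Everything rests on Z(L) being the orthogonal complement of L^2: it gives dim L^2 = 10 -
  4 = 6, so that L/L^2 has dimension 4, and, with L^3 = Z(L), it makes \<open>phi z\<close> for z in
  L^2 a form on L/L^2. The field is arbitrary, so no eigenvalue, generic parameter or division by 2
  is available. The Pfaffian of a form on a 4-dimensional space is quadratic, but along y1 + k x1
  its k^2 term is the Pfaffian of the degenerate form and vanishes. A polynomial of degree exactly 1
  has its root in every field, and at that root type B would be violated. Uniqueness and the
  converse both come from one formula: in coordinates of a presented basis, \<open>phi\<close> is a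
  sum of three determinants. Matching the coordinates of two presented algebras therefore preserves
  \<open>phi\<close>, and non-degeneracy recovers the product from \<open>phi\<close>.\<close>

context symplectic_alternating_algebra
begin

section \<open>Multilinearity and alternation of the form, the product and
  \<open>phi\<close>\<close>

lemma form_skew: "form y x = - form x y"
  using form_alternating[of "x + y"] form_alternating[of x] form_alternating[of y]
  by (simp add: form_simps eq_neg_iff_add_eq_0 add.commute)

lemma form_minus: "form (- x) y = - form x y" "form x (- y) = - form x y"
  using form_simps(3)[of "-1" x y] form_simps(4)[of x "-1" y] by simp_all

lemma form_diff: "form (x - x') y = form x y - form x' y" "form x (y - y') = form x y - form x y'"
  by (simp_all only: diff_conv_add_uminus form_simps form_minus)

lemma form_sum:
  "form (sum f A) y = (\<Sum>a\<in>A. form (f a) y)" "form y (sum f A) = (\<Sum>a\<in>A. form y (f a))"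
  by (induction A rule: infinite_finite_induct; simp add: form_simps)+

lemma mul_scale: "smul c x \<cdot> y = smul c (x \<cdot> y)" "x \<cdot> smul c y = smul c (x \<cdot> y)"
proof -
  interpret l: Vector_Spaces.linear smul smul "\<lambda>x. x \<cdot> y" for y
    by (rule mul_linear_left)
  interpret r: Vector_Spaces.linear smul smul "\<lambda>y. x \<cdot> y" for x
    by (rule mul_linear_right)
  show "smul c x \<cdot> y = smul c (x \<cdot> y)" "x \<cdot> smul c y = smul c (x \<cdot> y)"
    by (simp_all add: l.scale r.scale)
qed

lemma mul_minus: "(- x) \<cdot> y = - (x \<cdot> y)" "x \<cdot> (- y) = - (x \<cdot> y)"
  using mul_scale(1)[of "-1" x y] mul_scale(2)[of x "-1" y] by simp_all

lemma mul_skew: "y \<cdot> x = - (x \<cdot> y)"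
  using mul_alternating[of "x + y"] mul_alternating[of x] mul_alternating[of y]
  by (simp add: mul_add eq_neg_iff_add_eq_0 add.commute)

lemma mul_zero: "0 \<cdot> y = 0" "x \<cdot> 0 = 0"
  using mul_scale(1)[of 0 0 y] mul_scale(2)[of x 0 0] by simp_all

lemma form_eqI:
  assumes "\<And>y. form x y = form x' y"
  shows "x = x'"
  using form_nondegenerate[of "x - x'"] assms by (simp add: form_diff)

lemma phi_linear:
  "phi (x + x') y z = phi x y z + phi x' y z" "phi x (y + y') z = phi x y z + phi x y' z"
  "phi x y (z + z') = phi x y z + phi x y z'"
  "phi (x - x') y z = phi x y z - phi x' y z" "phi x (y - y') z = phi x y z - phi x y' z"
  "phi x y (z - z') = phi x y z - phi x y z'"
  "phi (- x) y z = - phi x y z" "phi x (- y) z = - phi x y z" "phi x y (- z) = - phi x y z"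
  "phi (smul c x) y z = c * phi x y z" "phi x (smul c y) z = c * phi x y z"
  "phi x y (smul c z) = c * phi x y z"
  "phi 0 y z = 0" "phi x 0 z = 0" "phi x y 0 = 0"
  by (simp_all add: phi_def mul_add mul_minus mul_scale mul_zero form_simps form_minus form_diff
      diff_conv_add_uminus del: add_uminus_conv_diff)

lemma phi_rotate: "phi y z x = phi x y z"
  unfolding phi_def by (metis form_mul_cyclic)

lemma phi_swap: "phi y x z = - phi x y z" "phi x z y = - phi x y z"
proof -
  show *: "phi y x z = - phi x y z" for x y z
    unfolding phi_def by (metis mul_skew form_minus(1))
  show "phi x z y = - phi x y z"
    by (metis * phi_rotate)
qed

text \<open>In characteristic 2 this does not follow from \<open>phi_swap\<close>; it comes from
  \<open>mul_alternating\<close>, and the cyclic identity moves the repeated entry to the other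
  places.\<close>

lemma phi_same: "phi x x z = 0" "phi x z z = 0" "phi x z x = 0"
proof -
  show *: "phi x x z = 0" for x z
    by (simp add: phi_def mul_alternating form_simps)
  show "phi x z z = 0" "phi x z x = 0"
    by (metis * phi_rotate)+
qed

section \<open>Orthogonality between the center and L^2\<close>

lemma center_iff: "z \<in> center \<longleftrightarrow> (\<forall>u v. phi z u v = 0)"
  unfolding center_def phi_def using form_nondegenerate form_simps(5) by auto

lemma phi_center:
  assumes "z \<in> center"
  shows "phi z u v = 0" "phi u z v = 0" "phi u v z = 0"
  using assms phi_rotate unfolding center_iff by metis+

lemma subspace_center: "subspace center"
  by (rule subspaceI) (simp_all add: center_iff phi_linear)

lemma subspace_lower_2: "subspace (lower 2)"
  by (simp add: lower_2)

lemma mul_in_lower_2: "u \<cdot> v \<in> lower 2"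
  unfolding lower_2 by (rule span_base) blast

lemma mul_lower_2_in_lower_3: "u \<in> lower 2 \<Longrightarrow> u \<cdot> v \<in> lower 3"
  unfolding lower_3 by (rule span_base) blast

text \<open>The cyclic identity (zu, v) = (uv, z): z annihilates L exactly if it is orthogonal to
  all products.\<close>

lemma center_eq_perp_lower_2: "z \<in> center \<longleftrightarrow> (\<forall>u\<in>lower 2. form z u = 0)"
proof
  assume *: "\<forall>u\<in>lower 2. form z u = 0"
  have "phi z u v = 0" for u v
  proof -
    have "phi z u v = form (u \<cdot> v) z"
      unfolding phi_def by (rule form_mul_cyclic)
    then show ?thesis
      using * mul_in_lower_2[of u v] form_skew[of z "u \<cdot> v"] by simp
  qed
  then show "z \<in> center"
    by (simp add: center_iff)
qed (simp add: form_center_lower_2)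

lemma finite_dimensional: "\<exists>B. finite_dimensional_vector_space smul B"
proof -
  obtain S where S: "finite S" "span S = UNIV"
    using finite_dim by blast
  obtain B where B: "B \<subseteq> S" "independent B" "S \<subseteq> span B"
    by (rule maximal_independent_subset)
  have "span B = UNIV"
    using S(2) B(3) span_minimal[OF B(3) subspace_span] by auto
  then have "finite_dimensional_vector_space smul B"
    using B S(1) finite_subset by unfold_locales auto
  then show ?thesis ..
qed

lemma finite_independent: "independent B \<Longrightarrow> finite B"
  using finite_dimensional finite_dimensional_vector_space.finiteI_independent by blast

text \<open>Induction on B in the manner of Gram-Schmidt. If c paired to zero with every vector
  orthogonal to B, non-degeneracy would make c a combination of B. So some vector orthogonal to B
  pairs with c; scaled, it is the dual vector of c and also corrects the old dual vectors.\<close>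

lemma independent_dual_vectors:
  assumes "finite B" "independent B"
  shows "\<exists>w. \<forall>b\<in>B. \<forall>b'\<in>B. form b' (w b) = (if b' = b then 1 else 0)"
  using assms
proof (induction B rule: finite_induct)
  case empty
  then show ?case by simp
next
  case (insert c B)
  have indep: "independent B" and c: "c \<notin> span B"
    using insert.prems insert.hyps(2) by (auto simp: independent_insert)
  obtain w where w: "\<And>b b'. b \<in> B \<Longrightarrow> b' \<in> B \<Longrightarrow> form b' (w b) = (if b' = b then 1 else 0)"
    using insert.IH[OF indep] by blast
  define r where "r v = v - (\<Sum>b\<in>B. smul (form b v) (w b))" for v
  have form_r: "form x (r v) = form x v - (\<Sum>b\<in>B. form b v * form x (w b))" for x v
    by (simp add: r_def form_diff form_sum form_simps)
  have r0: "form b (r v) = 0" if "b \<in> B" for b v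
  proof -
    have "(\<Sum>b'\<in>B. form b' v * form b (w b')) = (\<Sum>b'\<in>B. if b' = b then form b v else 0)"
      using that by (intro sum.cong) (auto simp: w)
    then show ?thesis
      using that insert.hyps(1) by (simp add: form_r)
  qed
  have "\<exists>v. form c (r v) \<noteq> 0"
  proof (rule ccontr)
    assume "\<not> ?thesis"
    then have *: "form c v = (\<Sum>b\<in>B. form b v * form c (w b))" for v
      unfolding form_r by (metis eq_iff_diff_eq_0)
    \<comment> \<open>The previous fact writes (c, v) as a combination of the (b, v) for all v at
      once; s is the same combination of the b themselves.\<close>
    define s where "s = (\<Sum>b\<in>B. smul (form c (w b)) b)"
    have "c = s"
      by (rule form_eqI) (subst *, simp add: s_def form_sum form_simps mult.commute)
    moreover have "s \<in> span B"
      unfolding s_def by (intro span_sum span_scale span_base)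
    ultimately show False
      using c by blast
  qed
  then obtain v where v: "form c (r v) \<noteq> 0" by blast
  define u where "u = smul (1 / form c (r v)) (r v)"
  have u: "form c u = 1" "b \<in> B \<Longrightarrow> form b u = 0" for b
    using v by (simp_all add: u_def form_simps r0)
  define w' where "w' b = (if b = c then u else w b - smul (form c (w b)) u)" for b
  have "\<forall>b\<in>insert c B. \<forall>b'\<in>insert c B. form b' (w' b) = (if b' = b then 1 else 0)"
    using insert.hyps(2) by (auto simp: w'_def u w form_diff form_simps)
  then show ?case by blast
qed

text \<open>L^2 contains its double orthogonal complement. Were v outside L^2, the vector dual to v
  relative to a basis of L^2 enlarged by v would be orthogonal to L^2, hence central, and yet v
  would pair with it to 1.\<close>

lemma perp_center_subset_lower_2:
  assumes "\<And>z. z \<in> center \<Longrightarrow> form z v = 0"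
  shows "v \<in> lower 2"
proof (rule ccontr)
  assume v: "v \<notin> lower 2"
  obtain D where D: "D \<subseteq> lower 2" "independent D" "lower 2 \<subseteq> span D"
    by (rule maximal_independent_subset)
  then have span_D: "span D = lower 2"
    using span_subspace subspace_lower_2 by blast
  then have "independent (insert v D)"
    using v D(2) by (simp add: independent_insertI)
  from independent_dual_vectors[OF finite_independent[OF this] this]
  obtain w where w: "\<And>b b'. b \<in> insert v D \<Longrightarrow> b' \<in> insert v D \<Longrightarrow>
      form b' (w b) = (if b' = b then 1 else 0)"
    by blast
  have vD: "v \<notin> D"
    using v D(1) by blast
  have "form u (w v) = 0" if "u \<in> lower 2" for u
    using that unfolding span_D[symmetric]
  proof (induction rule: span_induct_alt)
    case (step c x y)
    then show ?case using w[of v x] vD by (auto simp: form_simps)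
  qed (simp add: form_simps)
  then have "form (w v) u = 0" if "u \<in> lower 2" for u
    using that form_skew[of "w v" u] by (simp only: minus_zero)
  then have "form (w v) v = 0"
    by (intro assms) (simp add: center_eq_perp_lower_2)
  moreover have "form v (w v) = 1"
    using w by simp
  ultimately show False
    using form_skew[of "w v" v] by simp
qed

text \<open>The vectors dual to a basis B of the center span a complement of L^2: removing from v
  its components (b, v) along them leaves a vector orthogonal to the center, hence in L^2.\<close>

lemma dim_lower_2_add_dim_center: "dim (lower 2) + dim center = dim (UNIV :: 'v set)"
proof -
  obtain D where D: "D \<subseteq> lower 2" "independent D" "lower 2 \<subseteq> span D"
    by (rule maximal_independent_subset)
  obtain B where B: "B \<subseteq> center" "independent B" "center \<subseteq> span B"
    by (rule maximal_independent_subset)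
  have span_D: "span D = lower 2"
    using span_subspace subspace_lower_2 D by blast
  have fin: "finite D" "finite B"
    using D(2) B(2) finite_independent by blast+
  obtain w where w: "\<And>b b'. b \<in> B \<Longrightarrow> b' \<in> B \<Longrightarrow> form b' (w b) = (if b' = b then 1 else 0)"
    using independent_dual_vectors[OF fin(2) B(2)] by blast
  have form_w: "form b (\<Sum>b'\<in>A. smul (g b') (w b')) = (if b \<in> A then g b else 0)"
    if "b \<in> B" "A \<subseteq> B" for b A g
  proof -
    have A: "finite A" using that fin finite_subset by blast
    have "form b (\<Sum>b'\<in>A. smul (g b') (w b')) = (\<Sum>b'\<in>A. g b' * form b (w b'))"
      by (simp add: form_sum form_simps)
    also have "\<dots> = (\<Sum>b'\<in>A. if b' = b then g b else 0)"
      using that by (intro sum.cong) (auto simp: w)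
    finally show ?thesis using A by simp
  qed
  have inj: "inj_on w B"
  proof (rule inj_onI)
    fix a b assume "a \<in> B" "b \<in> B" "w a = w b"
    then show "a = b"
      using w[of a a] w[of b a] by (auto split: if_splits)
  qed
  \<comment> \<open>Stated for every subset A of B so that dual vectors can be adjoined one at a
    time: pairing with a annihilates L^2 and the other dual vectors, but not
    \<open>w a\<close>.\<close>
  have "independent (D \<union> w ` A)" "w ` A \<inter> D = {}" if "A \<subseteq> B" for A
  proof -
    have "finite A" using that fin finite_subset by blast
    from this that show "independent (D \<union> w ` A)"
    proof (induction A rule: finite_induct)
      case empty
      show ?case using D(2) by simp
    next
      case (insert a A)
      have "w a \<notin> span (D \<union> w ` A)"
      proof
        assume "w a \<in> span (D \<union> w ` A)"
        then have "form a (w a) = 0"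
        proof (induction rule: span_induct_alt)
          case (step c x y)
          have "form a x = 0"
          proof (cases "x \<in> D")
            case True
            then show ?thesis
              using B(1) D(1) insert.prems by (intro form_center_lower_2(1)) blast+
          next
            case False
            then obtain a' where a': "x = w a'" "a' \<in> A" using step(1) by blast
            moreover have "a \<noteq> a'" "a \<in> B" "a' \<in> B"
              using a' insert.prems insert.hyps(2) by blast+
            ultimately show ?thesis using w[of a' a] by simp
          qed
          then show ?case using step(2) by (simp add: form_simps)
        qed (simp add: form_simps)
        then show False using w[of a a] insert.prems by simp
      qed
      then show ?case using insert.IH insert.prems by (simp add: independent_insertI)
    qed
    show "w ` A \<inter> D = {}"
    proof (rule ccontr)
      assume "w ` A \<inter> D \<noteq> {}"
      then obtain a where "a \<in> B" "w a \<in> D" using \<open>A \<subseteq> B\<close> by blast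
      then have "form a (w a) = 0"
        using form_center_lower_2(1) B(1) D(1) by blast
      then show False using w[of a a] \<open>a \<in> B\<close> by simp
    qed
  qed
  from this[OF subset_refl] have indep: "independent (D \<union> w ` B)" and disj: "w ` B \<inter> D = {}" .
  have "v \<in> span (D \<union> w ` B)" for v
  proof -
    define s where "s = (\<Sum>b\<in>B. smul (form b v) (w b))"
    have *: "form b (v - s) = 0" if "b \<in> B" for b
      using that form_w[of b B] by (simp add: form_diff s_def)
    have "form z (v - s) = 0" if "z \<in> span B" for z
      using that by (induction rule: span_induct_alt) (simp_all add: form_simps *)
    then have "v - s \<in> lower 2"
      using B(3) by (intro perp_center_subset_lower_2) blast
    then have "v - s \<in> span (D \<union> w ` B)"
      unfolding span_D[symmetric] by (rule rev_subsetD) (rule span_mono, blast)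
    moreover have "s \<in> span (D \<union> w ` B)"
      unfolding s_def by (intro span_sum span_scale span_base) blast
    ultimately show ?thesis using span_add[of "v - s" _ s] by simp
  qed
  then have "UNIV \<subseteq> span (D \<union> w ` B)"
    by blast
  then have "dim (UNIV :: 'v set) = card (D \<union> w ` B)"
    using basis_card_eq_dim[OF subset_UNIV _ indep] by metis
  also have "\<dots> = card D + card B"
    using fin disj inj by (subst card_Un_disjoint) (auto simp: card_image)
  also have "card D = dim (lower 2)"
    using basis_card_eq_dim D by blast
  also have "card B = dim center"
    using basis_card_eq_dim B by blast
  finally show ?thesis ..
qed

end

section \<open>Coordinates with respect to a standard basis\<close>

lemma card_basis_indices: "finite (basis_indices n)" "card (basis_indices n) = 2 * n"
  unfolding basis_indices_def
  by (simp, subst card_Un_disjoint) (auto simp: card_image inj_on_def)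

lemma basis_indices_5:
  "basis_indices 5 = {X 1, X 2, X 3, X 4, X 5, Y 1, Y 2, Y 3, Y 4, Y 5}"
proof -
  have "{1..5::nat} = {1, 2, 3, 4, 5}"
    by auto
  then show ?thesis
    by (auto simp: basis_indices_def)
qed

text \<open>Presentations compare triples as sets; this recovers the six orderings, for which signs
  can be computed.\<close>

lemma insert3_eqD:
  assumes "{p, q, r} = {A, B, C}" "A \<noteq> B" "A \<noteq> C" "B \<noteq> C"
  shows "p = A \<and> q = B \<and> r = C \<or> p = B \<and> q = C \<and> r = A \<or> p = C \<and> q = A \<and> r = B \<or>
    p = B \<and> q = A \<and> r = C \<or> p = A \<and> q = C \<and> r = B \<or> p = C \<and> q = B \<and> r = A"
proof -
  have "p \<in> {A, B, C}" "q \<in> {A, B, C}" "r \<in> {A, B, C}"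
    using assms(1) by blast+
  moreover have "A = p \<or> A = q \<or> A = r" "B = p \<or> B = q \<or> B = r" "C = p \<or> C = q \<or> C = r"
    using assms(1) by blast+
  ultimately show ?thesis
    using assms(2-4) by (elim insertE emptyE) simp_all
qed

text \<open>The 3 by 3 determinant with rows f, g, h and columns u, v, w, that is, the wedge product
  of three linear functionals evaluated at (u, v, w).\<close>

definition det3 :: "('a \<Rightarrow> 'f::comm_ring_1) \<Rightarrow> ('a \<Rightarrow> 'f) \<Rightarrow> ('a \<Rightarrow> 'f) \<Rightarrow> 'a \<Rightarrow> 'a \<Rightarrow> 'a \<Rightarrow> 'f"
  where "det3 f g h u v w =
    f u * (g v * h w - h v * g w) - f v * (g u * h w - h u * g w) + f w * (g u * h v - h u * g v)"

context symplectic_alternating_algebra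
begin

text \<open>The part of \<open>standard_basis\<close> that speaks of the form alone; in the right
  dimension it forces the rest, see \<open>standard_basisI\<close>.\<close>

definition gram :: "nat \<Rightarrow> (basis_index \<Rightarrow> 'v) \<Rightarrow> bool"
  where "gram n b \<longleftrightarrow> (\<forall>i\<in>{1..n}. \<forall>j\<in>{1..n}.
      form (b (X i)) (b (X j)) = 0 \<and> form (b (Y i)) (b (Y j)) = 0 \<and>
      form (b (X i)) (b (Y j)) = (if i = j then 1 else 0))"

text \<open>The coefficient of \<open>b p\<close> in v, obtained by pairing with the partner of
  \<open>b p\<close>. The argument order differs in the two cases because (x_i, y_i) = 1 but (y_i,
  x_i) = -1.\<close>

definition coord :: "(basis_index \<Rightarrow> 'v) \<Rightarrow> basis_index \<Rightarrow> 'v \<Rightarrow> 'f"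
  where "coord b p v = (case p of X i \<Rightarrow> form v (b (Y i)) | Y i \<Rightarrow> form (b (X i)) v)"

lemma coord_simps:
  "coord b p (u + v) = coord b p u + coord b p v" "coord b p (u - v) = coord b p u - coord b p v"
  "coord b p (- u) = - coord b p u" "coord b p (smul c v) = c * coord b p v" "coord b p 0 = 0"
  by (simp_all add: coord_def form_simps form_minus form_diff split: basis_index.split)

lemma coord_sum: "coord b p (sum f A) = (\<Sum>a\<in>A. coord b p (f a))"
  by (simp add: coord_def form_sum split: basis_index.split)

lemma coord_basis:
  assumes "gram n b" "p \<in> basis_indices n" "q \<in> basis_indices n"
  shows "coord b p (b q) = (if p = q then 1 else 0)"
proof -
  have gramD: "form (b (X i)) (b (X j)) = 0" "form (b (Y i)) (b (Y j)) = 0"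
    "form (b (X i)) (b (Y j)) = (if i = j then 1 else 0)" if "i \<in> {1..n}" "j \<in> {1..n}" for i j
    using assms(1) that unfolding gram_def by blast+
  show ?thesis
    using assms(2,3) by (auto simp: basis_indices_def coord_def gramD split: if_split_asm)
qed

lemma coord_sum_basis:
  assumes "gram n b" "p \<in> basis_indices n"
  shows "coord b p (\<Sum>q\<in>basis_indices n. smul (c q) (b q)) = c p"
proof -
  have "coord b p (\<Sum>q\<in>basis_indices n. smul (c q) (b q)) =
      (\<Sum>q\<in>basis_indices n. if q = p then c p else 0)"
    unfolding coord_sum coord_simps using assms
    by (intro sum.cong) (auto simp: coord_basis)
  then show ?thesis
    using assms(2) card_basis_indices(1) by simp
qed

lemma form_basis_right:
  "form u (b q) = (case q of X i \<Rightarrow> - coord b (Y i) u | Y i \<Rightarrow> coord b (X i) u)"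
  by (cases q) (simp_all add: coord_def form_skew[of u "b (X i)" for i])

lemma standard_basis_gram: "standard_basis n b \<Longrightarrow> gram n b"
  unfolding standard_basis_def gram_def by blast

text \<open>Pairing a linear combination with the partner of a basis vector returns its coefficient,
  so the Gram relations give independence; \<open>2 * n\<close> independent vectors in dimension
  \<open>2 * n\<close> span.\<close>

lemma standard_basisI:
  assumes gram: "gram n b" and dim: "dim (UNIV :: 'v set) = 2 * n"
  shows "standard_basis n b"
proof -
  let ?I = "basis_indices n"
  have inj: "inj_on b ?I"
  proof (rule inj_onI)
    fix p q assume "p \<in> ?I" "q \<in> ?I" "b p = b q"
    then show "p = q"
      using coord_basis[OF gram, of p p] coord_basis[OF gram, of p q] by (simp split: if_splits)
  qed
  have indep: "independent (b ` ?I)"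
  proof (rule independent_if_scalars_zero)
    fix f x
    assume "(\<Sum>x\<in>b ` ?I. smul (f x) x) = 0" and "x \<in> b ` ?I"
    then obtain q where q: "q \<in> ?I" "x = b q" and 0: "(\<Sum>p\<in>?I. smul (f (b p)) (b p)) = 0"
      by (auto simp: sum.reindex[OF inj])
    show "f x = 0"
      using coord_sum_basis[OF gram q(1), of "\<lambda>p. f (b p)"] q(2) by (simp add: 0 coord_simps)
  qed (simp add: card_basis_indices)
  obtain B where "finite_dimensional_vector_space smul B"
    using finite_dimensional by blast
  then interpret fd: finite_dimensional_vector_space smul B .
  have "UNIV \<subseteq> span (b ` ?I)"
    by (rule fd.card_ge_dim_independent) (use indep dim in \<open>auto simp: card_image[OF inj] card_basis_indices\<close>)
  then show ?thesis
    using inj indep gram unfolding standard_basis_def gram_def by blast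
qed

lemma coord_expansion:
  assumes "standard_basis n b"
  shows "v = (\<Sum>p\<in>basis_indices n. smul (coord b p v) (b p))"
proof -
  have gram: "gram n b"
    using assms by (rule standard_basis_gram)
  have "v \<in> span (b ` basis_indices n)"
    using assms by (simp add: standard_basis_def)
  then show ?thesis
  proof (induction rule: span_induct_alt)
    case base
    show ?case by (simp add: coord_simps)
  next
    case (step c x y)
    then obtain q where q: "q \<in> basis_indices n" "x = b q"
      by blast
    have "(\<Sum>p\<in>basis_indices n. smul (coord b p x) (b p)) =
        (\<Sum>p\<in>basis_indices n. if p = q then b q else 0)"
      using q by (intro sum.cong) (auto simp: coord_basis[OF gram])
    then have "x = (\<Sum>p\<in>basis_indices n. smul (coord b p x) (b p))"
      using q card_basis_indices(1) by simp
    moreover have "(\<Sum>p\<in>basis_indices n. smul (coord b p (smul c x + y)) (b p)) =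
        smul c (\<Sum>p\<in>basis_indices n. smul (coord b p x) (b p)) +
        (\<Sum>p\<in>basis_indices n. smul (coord b p y) (b p))"
      by (simp add: coord_simps scale_sum_right scale_left_distrib sum.distrib)
    ultimately show ?case
      using step(2) by argo
  qed
qed

lemma coord_eqI:
  assumes "standard_basis n b" "\<And>p. p \<in> basis_indices n \<Longrightarrow> coord b p u = coord b p v"
  shows "u = v"
  using coord_expansion[OF assms(1), of u] coord_expansion[OF assms(1), of v] assms(2)
  by (metis (no_types, lifting) sum.cong)

text \<open>Permuting the arguments changes \<open>phi\<close> by at most a sign and leaves
  \<open>{p, q, r}\<close> alone, so vanishing has to be checked in one ordering of each triple
  only; \<open>key\<close> selects it.\<close>

lemma phi_eq_0_if_sorted:
  fixes key :: "basis_index \<Rightarrow> nat"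
  assumes inj: "inj_on key I"
    and sorted: "\<And>p q r. p \<in> I \<Longrightarrow> q \<in> I \<Longrightarrow> r \<in> I \<Longrightarrow> key p < key q \<Longrightarrow> key q < key r \<Longrightarrow>
      {p, q, r} \<notin> S \<Longrightarrow> phi (b p) (b q) (b r) = 0"
    and I: "p \<in> I" "q \<in> I" "r \<in> I" and S: "{p, q, r} \<notin> S"
  shows "phi (b p) (b q) (b r) = 0"
proof (cases "p = q \<or> q = r \<or> p = r")
  case True
  then show ?thesis by (auto simp: phi_same)
next
  case False
  define N where "N p q r \<longleftrightarrow> {p, q, r} \<notin> S \<longrightarrow> phi (b p) (b q) (b r) = 0" for p q r
  have N: "N q p r \<longleftrightarrow> N p q r" "N p r q \<longleftrightarrow> N p q r" for p q r
  proof -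
    have "{q, p, r} = {p, q, r}" "{p, r, q} = {p, q, r}"
      by blast+
    then show "N q p r \<longleftrightarrow> N p q r" "N p r q \<longleftrightarrow> N p q r"
      unfolding N_def phi_swap(1)[of "b q" "b p"] phi_swap(2)[of "b p" "b r"] by simp_all
  qed
  have N': "N q r p \<longleftrightarrow> N p q r" "N r p q \<longleftrightarrow> N p q r" "N r q p \<longleftrightarrow> N p q r"
      "N p r q \<longleftrightarrow> N p q r" "N q p r \<longleftrightarrow> N p q r"
    using N(2)[of q r p] N(1)[of r p q] N(1)[of r q p] N(2)[of p r q] N(1)[of q p r] by blast+
  have sorted': "N p q r" if "p \<in> I" "q \<in> I" "r \<in> I" "key p < key q" "key q < key r" for p q r
    using sorted that by (simp add: N_def)
  have "key p \<noteq> key q" "key q \<noteq> key r" "key p \<noteq> key r"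
    using False I inj_onD[OF inj] by blast+
  then have "key p < key q \<or> key q < key p" "key q < key r \<or> key r < key q"
      "key p < key r \<or> key r < key p"
    by linarith+
  then consider "key p < key q" "key q < key r" | "key p < key r" "key r < key q"
    | "key q < key p" "key p < key r" | "key q < key r" "key r < key p"
    | "key r < key p" "key p < key q" | "key r < key q" "key q < key p"
    by blast
  then have "N p q r"
    using sorted'[of p q r] sorted'[of p r q] sorted'[of q p r] sorted'[of q r p] sorted'[of r p q]
      sorted'[of r q p] I unfolding N' by cases blast+
  then show ?thesis
    using S by (simp add: N_def)
qed

section \<open>The trilinear form of the presentation\<close>

definition listed :: "basis_index set set"
  where "listed = {{X 1, Y 2, Y 3}, {Y 1, Y 2, Y 4}, {Y 1, Y 3, Y 5}}"

lemma has_presentation_iff: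
  "has_presentation 5 P_10_4_3 b \<longleftrightarrow> standard_basis 5 b \<and>
    phi (b (X 1)) (b (Y 2)) (b (Y 3)) = 1 \<and> phi (b (Y 1)) (b (Y 2)) (b (Y 4)) = 1 \<and>
    phi (b (Y 1)) (b (Y 3)) (b (Y 5)) = 1 \<and>
    (\<forall>p\<in>basis_indices 5. \<forall>q\<in>basis_indices 5. \<forall>r\<in>basis_indices 5.
      {p, q, r} \<notin> listed \<longrightarrow> phi (b p) (b q) (b r) = 0)"
  by (simp add: has_presentation_def P_10_4_3_def listed_def phi_def)

lemma has_presentationI:
  assumes basis: "standard_basis 5 b"
    and center: "b (X 2) \<in> center" "b (X 3) \<in> center" "b (X 4) \<in> center" "b (X 5) \<in> center"
    and x1: "\<And>v. phi (b (X 1)) (b (Y 1)) v = 0"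
      "phi (b (X 1)) (b (Y 2)) (b (Y 3)) = 1" "phi (b (X 1)) (b (Y 2)) (b (Y 4)) = 0"
      "phi (b (X 1)) (b (Y 2)) (b (Y 5)) = 0" "phi (b (X 1)) (b (Y 3)) (b (Y 4)) = 0"
      "phi (b (X 1)) (b (Y 3)) (b (Y 5)) = 0" "phi (b (X 1)) (b (Y 4)) (b (Y 5)) = 0"
    and y1: "phi (b (Y 1)) (b (Y 2)) (b (Y 3)) = 0" "phi (b (Y 1)) (b (Y 2)) (b (Y 4)) = 1"
      "phi (b (Y 1)) (b (Y 2)) (b (Y 5)) = 0" "phi (b (Y 1)) (b (Y 3)) (b (Y 4)) = 0"
      "phi (b (Y 1)) (b (Y 3)) (b (Y 5)) = 1" "phi (b (Y 1)) (b (Y 4)) (b (Y 5)) = 0"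
    and y2: "phi (b (Y 2)) (b (Y 3)) (b (Y 4)) = 0" "phi (b (Y 2)) (b (Y 3)) (b (Y 5)) = 0"
      "phi (b (Y 2)) (b (Y 4)) (b (Y 5)) = 0" "phi (b (Y 3)) (b (Y 4)) (b (Y 5)) = 0"
  shows "has_presentation 5 P_10_4_3 b"
proof -
  \<comment> \<open>The order x1 < y1 < ... < y5 < x2 < ... < x5 puts the central vectors last. A
    sorted triple contains one of x2, ..., x5 exactly if \<open>5 < key r\<close>; the other sorted
    triples are those covered by \<open>x1\<close>, \<open>y1\<close> and \<open>y2\<close>.\<close>
  define key :: "basis_index \<Rightarrow> nat"
    where "key p = (case p of X i \<Rightarrow> if i = 1 then 0 else i + 5 | Y i \<Rightarrow> i)" for p
  have key: "key (X i) = (if i = 1 then 0 else i + 5)" "key (Y i) = i" for i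
    by (simp_all add: key_def)
  have inj: "inj_on key (basis_indices 5)"
    unfolding basis_indices_5 by (auto simp: inj_on_def key)
  have sorted: "phi (b p) (b q) (b r) = 0"
    if I: "p \<in> basis_indices 5" "q \<in> basis_indices 5" "r \<in> basis_indices 5"
      and less: "key p < key q" "key q < key r" and un: "{p, q, r} \<notin> listed" for p q r
  proof (cases "5 < key r")
    case True
    then have "b r \<in> center"
      using I(3) center unfolding basis_indices_5 by (auto simp: key)
    then show ?thesis
      by (rule phi_center)
  next
    case False
    have *: "s \<in> {X 1, Y 1, Y 2, Y 3, Y 4, Y 5}" if "s \<in> basis_indices 5" "\<not> 5 < key s" for s
      using that unfolding basis_indices_5 by (auto simp: key)
    have less5: "\<not> 5 < key p" "\<not> 5 < key q"
      using False less by linarith+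
    note p = *[OF I(1) less5(1)] and q = *[OF I(2) less5(2)] and r = *[OF I(3) False]
    show ?thesis
    proof (cases "p = X 1 \<and> q = Y 2 \<and> r = Y 3 \<or> p = Y 1 \<and> q = Y 2 \<and> r = Y 4 \<or>
        p = Y 1 \<and> q = Y 3 \<and> r = Y 5")
      case True
      then have "{p, q, r} \<in> listed"
        unfolding listed_def by blast
      then show ?thesis using un by contradiction
    next
      case False
      from p q r show ?thesis
        by (elim insertE emptyE) (use False less in \<open>simp_all add: key x1 y1 y2 del: One_nat_def\<close>)
    qed
  qed
  show ?thesis
    unfolding has_presentation_iff
    by (intro conjI ballI impI basis x1(2) y1(2,5) phi_eq_0_if_sorted[OF inj sorted, where S = listed])
qed

text \<open>The coordinate matrix has entries 0 and 1. If the sets differ, one of the distinct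
  labels A, B, C is missing among p, q, r and its row is zero; if they agree, both sides are the
  sign of the same permutation.\<close>

lemma det3_coord_basis:
  assumes gram: "gram n b" and I: "A \<in> basis_indices n" "B \<in> basis_indices n" "C \<in> basis_indices n"
      "p \<in> basis_indices n" "q \<in> basis_indices n" "r \<in> basis_indices n"
    and distinct: "A \<noteq> B" "A \<noteq> C" "B \<noteq> C"
  shows "{p, q, r} \<noteq> {A, B, C} \<Longrightarrow>
      det3 (coord b A) (coord b B) (coord b C) (b p) (b q) (b r) = 0"
    and "{p, q, r} = {A, B, C} \<Longrightarrow> phi (b A) (b B) (b C) = 1 \<Longrightarrow>
      det3 (coord b A) (coord b B) (coord b C) (b p) (b q) (b r) = phi (b p) (b q) (b r)"
proof -
  have c: "coord b P (b Q) = (if P = Q then 1 else 0)" if "P \<in> {A, B, C}" "Q \<in> {p, q, r}" for P Q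
    using that I by (intro coord_basis[OF gram]) auto
  show "det3 (coord b A) (coord b B) (coord b C) (b p) (b q) (b r) = 0" if "{p, q, r} \<noteq> {A, B, C}"
  proof -
    have "\<not> {A, B, C} \<subseteq> {p, q, r}"
    proof
      assume "{A, B, C} \<subseteq> {p, q, r}"
      moreover have "card {p, q, r} \<le> card {A, B, C}"
        using distinct by (simp add: card_insert_if)
      ultimately show False
        using that card_seteq[of "{p, q, r}" "{A, B, C}"] by simp
    qed
    then consider "A \<notin> {p, q, r}" | "B \<notin> {p, q, r}" | "C \<notin> {p, q, r}"
      by blast
    then show ?thesis
      by cases (simp_all add: det3_def c)
  qed
  show "det3 (coord b A) (coord b B) (coord b C) (b p) (b q) (b r) = phi (b p) (b q) (b r)"
    if "{p, q, r} = {A, B, C}" and 1: "phi (b A) (b B) (b C) = 1"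
  proof -
    have v: "phi (b B) (b C) (b A) = 1" "phi (b C) (b A) (b B) = 1" "phi (b B) (b A) (b C) = -1"
      "phi (b A) (b C) (b B) = -1" "phi (b C) (b B) (b A) = -1"
      using 1 phi_rotate[of "b B" "b C" "b A"] phi_rotate[of "b C" "b A" "b B"]
        phi_swap(1)[of "b B" "b A" "b C"] phi_swap(2)[of "b A" "b C" "b B"]
        phi_swap(1)[of "b C" "b B" "b A"]
      by simp_all
    from insert3_eqD[OF that(1) distinct] show ?thesis
      using distinct by (elim disjE conjE) (simp_all add: det3_def c 1 v)
  qed
qed

text \<open>Both sides are trilinear, so basis triples suffice, and there each determinant detects
  the permutations of one listed triple. Hence \<open>phi\<close> depends only on coordinates, which
  drives both the invariants of the presented algebra and its uniqueness.\<close>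

lemma has_presentation_phi:
  assumes "has_presentation 5 P_10_4_3 b"
  shows "phi u v w =
    det3 (coord b (X 1)) (coord b (Y 2)) (coord b (Y 3)) u v w +
    det3 (coord b (Y 1)) (coord b (Y 2)) (coord b (Y 4)) u v w +
    det3 (coord b (Y 1)) (coord b (Y 3)) (coord b (Y 5)) u v w"
proof -
  note P = assms[unfolded has_presentation_iff]
  have gram: "gram 5 b"
    using P standard_basis_gram by blast
  have in_span: "v \<in> span (b ` basis_indices 5)" for v
    using P by (simp add: standard_basis_def)
  define D1 where "D1 = det3 (coord b (X 1)) (coord b (Y 2)) (coord b (Y 3))"
  define D2 where "D2 = det3 (coord b (Y 1)) (coord b (Y 2)) (coord b (Y 4))"
  define D3 where "D3 = det3 (coord b (Y 1)) (coord b (Y 3)) (coord b (Y 5))"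
  define D where "D u v w = D1 u v w + D2 u v w + D3 u v w" for u v w
  have D_linear: "D 0 v w = 0" "D u 0 w = 0" "D u v 0 = 0"
    "D (smul c u + u') v w = c * D u v w + D u' v w"
    "D u (smul c v + v') w = c * D u v w + D u v' w"
    "D u v (smul c w + w') = c * D u v w + D u v w'" for u u' v v' w w' c
    by (simp_all add: D_def D1_def D2_def D3_def det3_def coord_simps algebra_simps)
  have base: "phi (b p) (b q) (b r) = D (b p) (b q) (b r)"
    if I: "p \<in> basis_indices 5" "q \<in> basis_indices 5" "r \<in> basis_indices 5" for p q r
  proof -
    have mem: "X 1 \<in> basis_indices 5" "Y 1 \<in> basis_indices 5" "Y 2 \<in> basis_indices 5"
      "Y 3 \<in> basis_indices 5" "Y 4 \<in> basis_indices 5" "Y 5 \<in> basis_indices 5"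
      by (simp_all add: basis_indices_5)
    have distinct: "X 1 \<noteq> Y 2" "X 1 \<noteq> Y 3" "Y 2 \<noteq> Y 3" "Y 1 \<noteq> Y 2" "Y 1 \<noteq> Y 4" "Y 2 \<noteq> Y 4"
      "Y 1 \<noteq> Y 3" "Y 1 \<noteq> Y 5" "Y 3 \<noteq> Y 5"
      by simp_all
    note d1 = det3_coord_basis[OF gram mem(1,3,4) I distinct(1-3), folded D1_def]
    note d2 = det3_coord_basis[OF gram mem(2,3,5) I distinct(4-6), folded D2_def]
    note d3 = det3_coord_basis[OF gram mem(2,4,6) I distinct(7-9), folded D3_def]
    have ne: "{X 1, Y 2, Y 3} \<noteq> {Y 1, Y 2, Y 4}" "{X 1, Y 2, Y 3} \<noteq> {Y 1, Y 3, Y 5}"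
      "{Y 1, Y 2, Y 4} \<noteq> {Y 1, Y 3, Y 5}"
    proof -
      have "X 1 \<notin> {Y 1, Y 2, Y 4}" "X 1 \<notin> {Y 1, Y 3, Y 5}" "Y 2 \<notin> {Y 1, Y 3, Y 5}"
        by simp_all
      then show "{X 1, Y 2, Y 3} \<noteq> {Y 1, Y 2, Y 4}" "{X 1, Y 2, Y 3} \<noteq> {Y 1, Y 3, Y 5}"
        "{Y 1, Y 2, Y 4} \<noteq> {Y 1, Y 3, Y 5}"
        by (metis insertI1, metis insertI1, metis insertI1 insertI2)
    qed
    consider "{p, q, r} \<notin> listed" | "{p, q, r} = {X 1, Y 2, Y 3}" | "{p, q, r} = {Y 1, Y 2, Y 4}"
      | "{p, q, r} = {Y 1, Y 3, Y 5}"
      unfolding listed_def by blast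
    then show ?thesis
    proof cases
      case 1
      then have "phi (b p) (b q) (b r) = 0"
        using P I by blast
      moreover have "D1 (b p) (b q) (b r) = 0" "D2 (b p) (b q) (b r) = 0" "D3 (b p) (b q) (b r) = 0"
        using 1 unfolding listed_def by (intro d1(1) d2(1) d3(1); blast)+
      ultimately show ?thesis
        by (simp only: D_def add_0)
    next
      case 2
      have "D1 (b p) (b q) (b r) = phi (b p) (b q) (b r)"
        using 2 P by (intro d1(2)) blast+
      moreover have "D2 (b p) (b q) (b r) = 0" "D3 (b p) (b q) (b r) = 0"
        by (intro d2(1) d3(1); use 2 ne in metis)+
      ultimately show ?thesis
        by (simp only: D_def add_0 add_0_right)
    next
      case 3
      have "D2 (b p) (b q) (b r) = phi (b p) (b q) (b r)"
        using 3 P by (intro d2(2)) blast+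
      moreover have "D1 (b p) (b q) (b r) = 0" "D3 (b p) (b q) (b r) = 0"
        by (intro d1(1) d3(1); use 3 ne in metis)+
      ultimately show ?thesis
        by (simp only: D_def add_0 add_0_right)
    next
      case 4
      have "D3 (b p) (b q) (b r) = phi (b p) (b q) (b r)"
        using 4 P by (intro d3(2)) blast+
      moreover have "D1 (b p) (b q) (b r) = 0" "D2 (b p) (b q) (b r) = 0"
        by (intro d1(1) d2(1); use 4 ne in metis)+
      ultimately show ?thesis
        by (simp only: D_def add_0 add_0_right)
    qed
  qed
  have base2: "phi (b p) (b q) w = D (b p) (b q) w"
    if "p \<in> basis_indices 5" "q \<in> basis_indices 5" for p q w
    using in_span[of w]
    by (induction rule: span_induct_alt) (auto simp: phi_linear D_linear base that)
  have base1: "phi (b p) v w = D (b p) v w" if "p \<in> basis_indices 5" for p v w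
    using in_span[of v]
    by (induction rule: span_induct_alt) (auto simp: phi_linear D_linear base2 that)
  have "phi u v w = D u v w"
    using in_span[of u]
    by (induction rule: span_induct_alt) (auto simp: phi_linear D_linear base1)
  then show ?thesis
    by (simp only: D_def D1_def D2_def D3_def)
qed

section \<open>The degenerate form on L/L^2 and its radical\<close>

lemma phi_lower_2:
  assumes "lower 3 = center" "s \<in> lower 2" "t \<in> lower 2"
  shows "phi s t v = 0" "phi s v t = 0"
proof -
  \<comment> \<open>L^2 L lies in L^3 = Z(L), which is orthogonal to L^2. Thus \<open>phi s\<close>
    lives on L/L^2, and L^2 is abelian.\<close>
  have "s \<cdot> v \<in> center"
    using mul_lower_2_in_lower_3[OF assms(2)] assms(1) by blast
  then show "phi s v t = 0"
    unfolding phi_def using assms(3) by (rule form_center_lower_2(1))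
  then show "phi s t v = 0"
    using phi_swap(2)[of s t v] by simp
qed

text \<open>A nonzero degenerate alternating form on a 4-dimensional space has rank 2: a, b is a
  hyperbolic pair for \<open>phi x\<close>, and u, v span its radical modulo L^2. The last
  conclusion says, as a vanishing test, that a, b, u, v and L^2 span L.\<close>

lemma radical_frame:
  assumes dim: "dim (UNIV :: 'v set) = 10" "dim center = 4" and lower3: "lower 3 = center"
    and x: "x \<in> lower 2" "x \<notin> center" "degenerate_mod (lower 2) (phi x)"
  obtains a b u v where "phi x a b = 1" "\<And>w. phi x u w = 0" "\<And>w. phi x v w = 0"
    "\<And>p q. smul p u + smul q v \<in> lower 2 \<Longrightarrow> p = 0 \<and> q = 0"
    "\<And>s t w. t \<in> lower 2 \<Longrightarrow> phi t s a = 0 \<Longrightarrow> phi t s b = 0 \<Longrightarrow> phi t s u = 0 \<Longrightarrow> phi t s v = 0 \<Longrightarrow>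
      phi t s w = 0"
proof -
  note L2 = phi_lower_2[OF lower3]
  obtain a b0 where ab0: "phi x a b0 \<noteq> 0"
    using x(2) center_iff by blast
  define b where "b = smul (1 / phi x a b0) b0"
  have ab: "phi x a b = 1"
    using ab0 by (simp add: b_def phi_linear)
  then have ba: "phi x b a = -1"
    using phi_swap(2)[of x b a] by simp
  obtain u where u: "u \<notin> lower 2" "\<And>w. phi x u w = 0"
    using x(3) unfolding degenerate_mod_def by blast
  obtain D where D: "D \<subseteq> lower 2" "independent D" "lower 2 \<subseteq> span D" "card D = dim (lower 2)"
    by (rule basis_exists)
  have span_D: "span D = lower 2"
    using span_subspace subspace_lower_2 D by blast
  have card_D: "card D = 6" "finite D"
    using D(4) dim_lower_2_add_dim_center dim finite_independent[OF D(2)] by simp_all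
  have b: "b \<notin> span D"
    using L2(2)[OF x(1), of b a] ab unfolding span_D by auto
  have a: "a \<notin> span (insert b D)"
  proof
    assume "a \<in> span (insert b D)"
    then obtain k where "a - smul k b \<in> lower 2"
      unfolding span_breakdown_eq span_D by blast
    from L2(1)[OF x(1) this, of b] show False
      using ab by (simp add: phi_linear phi_same)
  qed
  have u': "u \<notin> span (insert a (insert b D))"
  proof
    assume "u \<in> span (insert a (insert b D))"
    then obtain k m where *: "u - smul k a - smul m b \<in> lower 2"
      unfolding span_breakdown_eq span_D by blast
    have "k = 0" "m = 0"
      using L2(1)[OF x(1) *, of a] L2(1)[OF x(1) *, of b] ab ba u(2) by (simp_all add: phi_linear phi_same)
    then show False
      using u(1) * by simp
  qed
  define E where "E = insert u (insert a (insert b D))"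
  have indep_E: "independent E"
    unfolding E_def using D(2) a b u' by (intro independent_insertI)
  have "b \<notin> D" "a \<notin> insert b D" "u \<notin> insert a (insert b D)"
    using span_base b a u' by metis+
  then have card_E: "card E = 9" "finite E"
    using card_D by (simp_all add: E_def)
  \<comment> \<open>6 + 3 = 9 vectors do not span dimension 10, so a tenth vector v0 completes a
    basis.\<close>
  have "\<not> UNIV \<subseteq> span E"
    using dim_le_card[of UNIV E] card_E dim(1) by auto
  then obtain v0 where v0: "v0 \<notin> span E"
    by blast
  have "v0 \<notin> E"
    using v0 span_base by metis
  then have card: "card (insert v0 E) = 10"
    using card_E by simp
  obtain B where "finite_dimensional_vector_space smul B"
    using finite_dimensional by blast
  then interpret fd: finite_dimensional_vector_space smul B .
  have span: "UNIV \<subseteq> span (insert v0 E)"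
    using indep_E v0 card dim(1) by (intro fd.card_ge_dim_independent independent_insertI) auto
  \<comment> \<open>The projection of v0 along the hyperbolic pair, which makes it orthogonal to a
    and b under \<open>phi x\<close>.\<close>
  define v where "v = v0 - smul (phi x v0 b) a + smul (phi x v0 a) b"
  have v_ab: "phi x v a = 0" "phi x v b = 0"
    by (simp_all add: v_def phi_linear phi_same ab ba)
  have v_u: "phi x v u = 0"
    using phi_swap(2)[of x v u] u(2)[of v] by simp
  have decompose: "\<exists>k l m n. w - (smul k v + smul l u + smul m a + smul n b) \<in> lower 2" for w
  proof -
    have "w \<in> span (insert v0 E)"
      using span by blast
    then obtain k l m n where *: "w - smul k v0 - smul l u - smul m a - smul n b \<in> lower 2"
      unfolding E_def span_breakdown_eq span_D by blast
    have "w - smul k v0 - smul l u - smul m a - smul n b =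
        w - (smul k v + smul l u + smul (m + k * phi x v0 b) a + smul (n - k * phi x v0 a) b)"
      by (simp add: v_def algebra_simps)
    with * show ?thesis
      by metis
  qed
  have extend: "phi t s w = 0" if t: "t \<in> lower 2" and 0: "phi t s a = 0" "phi t s b = 0" "phi t s u = 0" "phi t s v = 0" for s t w
  proof -
    obtain k l m n where "w - (smul k v + smul l u + smul m a + smul n b) \<in> lower 2"
      using decompose by blast
    from L2(2)[OF t this, of s] show ?thesis
      using 0 by (simp add: phi_linear)
  qed
  \<comment> \<open>Orthogonality to a, b and u is arranged, and v is orthogonal to itself because
    the form alternates; this is the evenness of the rank at work.\<close>
  have v: "phi x v w = 0" for w
    using extend[OF x(1)] v_ab v_u phi_same(2) by blast
  have "p = 0 \<and> q = 0" if "smul p u + smul q v \<in> lower 2" for p q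
  proof (cases "q = 0")
    case True
    show ?thesis
    proof (cases "p = 0")
      case False
      then have "u = smul (1 / p) (smul p u + smul q v)"
        using True by simp
      then have "u \<in> lower 2"
        using that subspace_scale[OF subspace_lower_2] by metis
      then show ?thesis using u(1) by contradiction
    qed (use True in simp)
  next
    case False
    \<comment> \<open>With q nonzero, solving for v and undoing the projection would put v0 into the
      span of E.\<close>
    define s where "s = smul p u + smul q v"
    have "s \<in> span E"
      using that span_mono[of D E] unfolding span_D E_def s_def by blast
    moreover have "u \<in> span E" "a \<in> span E" "b \<in> span E"
      by (auto simp: E_def intro: span_base)
    ultimately have "smul (1 / q) s - smul (p / q) u + smul (phi x v0 b) a - smul (phi x v0 a) b \<in> span E"
      by (intro span_add span_diff span_scale)
    also have "smul (1 / q) s - smul (p / q) u + smul (phi x v0 b) a - smul (phi x v0 a) b = v0"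
      using False by (simp add: v_def s_def scale_right_distrib)
    finally show ?thesis
      using v0 by contradiction
  qed
  then show ?thesis
    using that[OF ab u(2) v _ extend] by blast
qed

section \<open>Invariants of the presented algebra\<close>

lemma has_presentation_type_B:
  assumes P: "has_presentation 5 P_10_4_3 b"
  shows "nilpotent" "dim (UNIV :: 'v set) = 10" "isotropic center" "dim center = 4"
    "lower 3 = center" "type_B"
proof -
  have basis: "standard_basis 5 b"
    using P has_presentation_iff by blast
  note gram = standard_basis_gram[OF basis]
  define x1 x2 x3 x4 x5 where x: "x1 = b (X 1)" "x2 = b (X 2)" "x3 = b (X 3)" "x4 = b (X 4)" "x5 = b (X 5)"
  define y1 y2 y3 y4 y5 where y: "y1 = b (Y 1)" "y2 = b (Y 2)" "y3 = b (Y 3)" "y4 = b (Y 4)" "y5 = b (Y 5)"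
  define a1 a2 a3 a4 a5 where a: "a1 = coord b (X 1)" "a2 = coord b (X 2)" "a3 = coord b (X 3)"
    "a4 = coord b (X 4)" "a5 = coord b (X 5)"
  define e1 e2 e3 e4 e5 where e: "e1 = coord b (Y 1)" "e2 = coord b (Y 2)" "e3 = coord b (Y 3)"
    "e4 = coord b (Y 4)" "e5 = coord b (Y 5)"
  have cb: "coord b p (b q) = (if p = q then 1 else 0)"
    if "p \<in> {X 1, X 2, X 3, X 4, X 5, Y 1, Y 2, Y 3, Y 4, Y 5}"
      "q \<in> {X 1, X 2, X 3, X 4, X 5, Y 1, Y 2, Y 3, Y 4, Y 5}" for p q
    using that unfolding basis_indices_5[symmetric] by (rule coord_basis[OF gram])
  have c0:
    "a1 x1 = 1" "a1 x2 = 0" "a1 x3 = 0" "a1 x4 = 0" "a1 x5 = 0" "a1 y1 = 0" "a1 y2 = 0" "a1 y3 = 0" "a1 y4 = 0" "a1 y5 = 0"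
    "e1 x1 = 0" "e1 x2 = 0" "e1 x3 = 0" "e1 x4 = 0" "e1 x5 = 0" "e1 y1 = 1" "e1 y2 = 0" "e1 y3 = 0" "e1 y4 = 0" "e1 y5 = 0"
    "e2 x1 = 0" "e2 x2 = 0" "e2 x3 = 0" "e2 x4 = 0" "e2 x5 = 0" "e2 y1 = 0" "e2 y2 = 1" "e2 y3 = 0" "e2 y4 = 0" "e2 y5 = 0"
    "e3 x1 = 0" "e3 x2 = 0" "e3 x3 = 0" "e3 x4 = 0" "e3 x5 = 0" "e3 y1 = 0" "e3 y2 = 0" "e3 y3 = 1" "e3 y4 = 0" "e3 y5 = 0"
    "e4 x1 = 0" "e4 x2 = 0" "e4 x3 = 0" "e4 x4 = 0" "e4 x5 = 0" "e4 y1 = 0" "e4 y2 = 0" "e4 y3 = 0" "e4 y4 = 1" "e4 y5 = 0"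
    "e5 x1 = 0" "e5 x2 = 0" "e5 x3 = 0" "e5 x4 = 0" "e5 x5 = 0" "e5 y1 = 0" "e5 y2 = 0" "e5 y3 = 0" "e5 y4 = 0" "e5 y5 = 1"
    unfolding x y a e by (subst cb; simp)+
  have lin: "f (u - v) = f u - f v" "f (smul r v) = r * f v"
    if "f \<in> {a1, e1, e2, e3, e4, e5}" for f u v r
    using that unfolding a e by (auto simp: coord_simps)
  have form_x: "form x1 v = e1 v" "form x2 v = e2 v" "form x3 v = e3 v" "form x4 v = e4 v"
      "form x5 v = e5 v" "form v y1 = a1 v" for v
    unfolding x e y a by (simp_all add: coord_def)
  have phi: "phi u v w = det3 a1 e2 e3 u v w + det3 e1 e2 e4 u v w + det3 e1 e3 e5 u v w" for u v w
    unfolding a e by (rule has_presentation_phi[OF P])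
  note phi = phi[unfolded det3_def]
  have expansion: "v = smul (a1 v) x1 + (smul (a2 v) x2 + (smul (a3 v) x3 + (smul (a4 v) x4 + (smul (a5 v) x5 +
      (smul (e1 v) y1 + (smul (e2 v) y2 + (smul (e3 v) y3 + (smul (e4 v) y4 + smul (e5 v) y5))))))))" for v
  proof -
    have "(\<Sum>p\<in>{X 1, X 2, X 3, X 4, X 5, Y 1, Y 2, Y 3, Y 4, Y 5}. f p) =
      f (X 1) + (f (X 2) + (f (X 3) + (f (X 4) + (f (X 5) +
      (f (Y 1) + (f (Y 2) + (f (Y 3) + (f (Y 4) + f (Y 5)))))))))" for f :: "basis_index \<Rightarrow> 'v"
      by simp
    then show ?thesis
      unfolding x y a e by (rule trans[OF coord_expansion[OF basis, unfolded basis_indices_5]])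
  qed
  have center_coord: "z \<in> center \<longleftrightarrow> a1 z = 0 \<and> e1 z = 0 \<and> e2 z = 0 \<and> e3 z = 0 \<and> e4 z = 0 \<and> e5 z = 0"
    (is "_ \<longleftrightarrow> ?R") for z
  proof
    assume z: "z \<in> center"
    show ?R
      \<comment> \<open>Each of these pairs lies in exactly one listed triple, so
        \<open>phi z\<close> on it is, up to sign, the coordinate of z at the third entry.\<close>
      using phi_center(1)[OF z, of y2 y3] phi_center(1)[OF z, of y2 y4] phi_center(1)[OF z, of x1 y3]
        phi_center(1)[OF z, of x1 y2] phi_center(1)[OF z, of y1 y2] phi_center(1)[OF z, of y1 y3]
      by (simp add: phi c0)
  next
    assume ?R
    then show "z \<in> center"
      unfolding center_iff by (simp add: phi)
  qed
  have xc: "x2 \<in> center" "x3 \<in> center" "x4 \<in> center" "x5 \<in> center"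
    by (simp_all add: center_coord c0)
  have center_span: "center = span {x2, x3, x4, x5}"
  proof
    show "span {x2, x3, x4, x5} \<subseteq> center"
      using xc by (intro span_minimal subspace_center) blast
    show "center \<subseteq> span {x2, x3, x4, x5}"
    proof
      fix z assume "z \<in> center"
      then have "z = smul (a2 z) x2 + (smul (a3 z) x3 + (smul (a4 z) x4 + smul (a5 z) x5))"
        using expansion[of z] by (simp only: center_coord scale_zero_left add_0 add_0_right)
      moreover have "smul (a2 z) x2 + (smul (a3 z) x3 + (smul (a4 z) x4 + smul (a5 z) x5)) \<in>
          span {x2, x3, x4, x5}"
        by (intro span_add span_scale span_base) blast+
      ultimately show "z \<in> span {x2, x3, x4, x5}"
        by (rule ssubst)
    qed
  qed
  \<comment> \<open>Dual to the listed triples: the product of two entries of a triple is, up to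
    sign, the partner of the third. The order of factors absorbs the signs.\<close>
  have products: "y2 \<cdot> y4 = x1" "y3 \<cdot> y2 = y1" "y4 \<cdot> y1 = x2" "y5 \<cdot> y1 = x3" "y1 \<cdot> y2 = x4" "y1 \<cdot> y3 = x5"
    by (rule form_eqI, simp add: phi_def[symmetric] phi c0 form_x form_skew[of y1])+
  have lower2_coord: "v \<in> lower 2 \<longleftrightarrow> e2 v = 0 \<and> e3 v = 0 \<and> e4 v = 0 \<and> e5 v = 0" (is "_ \<longleftrightarrow> ?R") for v
  proof
    assume v: "v \<in> lower 2"
    show ?R
      using form_center_lower_2(1)[OF _ v] xc unfolding form_x[symmetric] by blast
  next
    assume ?R
    then have "v = smul (a1 v) x1 + (smul (a2 v) x2 + (smul (a3 v) x3 + (smul (a4 v) x4 + (smul (a5 v) x5 +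
        smul (e1 v) y1))))"
      using expansion[of v] by (simp only: scale_zero_left add_0 add_0_right)
    moreover have "smul (a1 v) x1 + (smul (a2 v) x2 + (smul (a3 v) x3 + (smul (a4 v) x4 + (smul (a5 v) x5 +
        smul (e1 v) y1)))) \<in> lower 2"
      using mul_in_lower_2[of y2 y4] mul_in_lower_2[of y3 y2] mul_in_lower_2[of y4 y1]
        mul_in_lower_2[of y5 y1] mul_in_lower_2[of y1 y2] mul_in_lower_2[of y1 y3]
      unfolding products by (intro subspace_add[OF subspace_lower_2] subspace_scale[OF subspace_lower_2])
    ultimately show "v \<in> lower 2"
      by (rule ssubst)
  qed
  show lower3: "lower 3 = center"
  proof
    show "lower 3 \<subseteq> center"
      unfolding lower_3
    proof (intro span_minimal subspace_center subsetI)
      fix z assume "z \<in> {u \<cdot> v |u v. u \<in> lower 2}"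
      then obtain u v where z: "z = u \<cdot> v" and u: "u \<in> lower 2"
        by blast
      have "form w (u \<cdot> v) = - phi u v w" for w
        using form_skew[of w "u \<cdot> v"] by (simp add: phi_def)
      moreover have "a1 (u \<cdot> v) = phi u v y1"
        by (simp add: phi_def form_x)
      ultimately show "z \<in> center"
        using u by (simp add: z center_coord form_x[symmetric] lower2_coord)
          (simp add: form_x phi c0)
    qed
    \<comment> \<open>Each of x2, ..., x5 is a product with the factor y1; as y1 is in L^2, these
      products lie in L^3.\<close>
    have y1: "y1 \<in> lower 2"
      by (simp add: lower2_coord c0)
    have "y1 \<cdot> v \<in> lower 3" "v \<cdot> y1 \<in> lower 3" for v
      using mul_lower_2_in_lower_3[OF y1, of v] mul_skew[of v y1] span_neg
      unfolding lower_3 by simp_all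
    then show "center \<subseteq> lower 3"
      unfolding center_span using products
      by (intro span_minimal) (force, simp add: lower_3)
  qed
  \<comment> \<open>L^4 = L^3 L = Z(L) L = 0, so k = 3 witnesses nilpotency.\<close>
  have "lower (3 + 1) = {0}"
  proof -
    have "0 \<in> center"
      by (simp add: center_def mul_zero)
    then have "{u \<cdot> v |u v. u \<in> center \<and> v \<in> UNIV} = {0}"
      by (fastforce simp: center_def)
    then show ?thesis
      using lower3 lower.simps(2)[of 3] by (simp add: mul_span_def)
  qed
  then show "nilpotent"
    unfolding nilpotent_def by blast
  have inj: "inj_on b (basis_indices 5)" and indep: "independent (b ` basis_indices 5)"
    and span: "span (b ` basis_indices 5) = UNIV"
    using basis unfolding standard_basis_def by blast+
  have "dim (UNIV :: 'v set) = card (b ` basis_indices 5)"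
    using basis_card_eq_dim[OF subset_UNIV _ indep] span by simp
  then show "dim (UNIV :: 'v set) = 10"
    by (simp add: card_image[OF inj] card_basis_indices)
  have sub: "{X 2, X 3, X 4, X 5} \<subseteq> basis_indices 5"
    by (simp add: basis_indices_5)
  have "dim center = card (b ` {X 2, X 3, X 4, X 5})"
    unfolding center_span x using independent_mono[OF indep image_mono[OF sub]]
    by (simp add: dim_span_eq_card_independent del: dim_span)
  then show "dim center = 4"
    by (simp only: card_image[OF inj_on_subset[OF inj sub]]) simp
  have "center \<subseteq> lower 2"
    using center_coord lower2_coord by blast
  then show "isotropic center"
    unfolding isotropic_def using form_center_lower_2(1) by blast
  show "type_B"
    unfolding type_B_def
  proof (intro bexI conjI ballI impI)
    show "x1 \<in> lower 2" "x1 \<notin> center"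
      by (simp_all add: lower2_coord center_coord c0)
    show "degenerate_mod (lower 2) (phi x1)"
      unfolding degenerate_mod_def
      \<comment> \<open>x1 and y4 share no listed triple, so y4 lies in the radical of
        \<open>phi x1\<close>.\<close>
      by (rule exI[of _ y4]) (simp add: lower2_coord phi c0)
    fix t assume t: "t \<in> lower 2" and *: "\<forall>c. t - smul c x1 \<notin> center"
    have t0: "e2 t = 0" "e3 t = 0" "e4 t = 0" "e5 t = 0"
      using t lower2_coord by blast+
    \<comment> \<open>If the y1-coordinate of t vanished, subtracting \<open>a1 t\<close> times x1
      would leave a central element.\<close>
    have t1: "e1 t \<noteq> 0"
      using *[rule_format, of "a1 t"] by (auto simp: center_coord lin c0 t0)
    show "\<not> degenerate_mod (lower 2) (phi t)"
      unfolding degenerate_mod_def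
    proof (rule notI, elim exE conjE)
      fix u assume u: "u \<notin> lower 2" "\<forall>v. phi t u v = 0"
      \<comment> \<open>A triangular system: y4 and y5 give \<open>e2 u = 0\<close> and
        \<open>e3 u = 0\<close> after division by \<open>e1 t\<close>; then y2 and y3 give
        \<open>e4 u = 0\<close> and \<open>e5 u = 0\<close>, whatever \<open>a1 t\<close>
        is.\<close>
      have "phi t u y4 = 0" "phi t u y5 = 0" "phi t u y2 = 0" "phi t u y3 = 0"
        using u by blast+
      then have "e2 u = 0 \<and> e3 u = 0 \<and> e4 u = 0 \<and> e5 u = 0"
        using t1 by (simp add: phi c0 t0)
      then show False
        using u(1) lower2_coord by blast
    qed
  qed
qed

section \<open>Simultaneous normal form of the two alternating forms\<close>

lemma normal_frame:
  assumes dim: "dim (UNIV :: 'v set) = 10" "dim center = 4" and lower3: "lower 3 = center" and "type_B"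
  obtains x1 y1 y2 y3 y4 y5 where "x1 \<in> lower 2" "y1 \<in> lower 2" "form x1 y1 = 1"
    "phi x1 y2 y3 = 1" "\<And>w. phi x1 y4 w = 0" "\<And>w. phi x1 y5 w = 0"
    "phi y1 y2 y3 = 0" "phi y1 y2 y4 = 1" "phi y1 y2 y5 = 0"
    "phi y1 y3 y4 = 0" "phi y1 y3 y5 = 1" "phi y1 y4 y5 = 0"
proof -
  note L2 = phi_lower_2[OF lower3]
  obtain x where x: "x \<in> lower 2" "x \<notin> center" "degenerate_mod (lower 2) (phi x)"
    and nondeg: "\<And>t. t \<in> lower 2 \<Longrightarrow> (\<And>c. t - smul c x \<notin> center) \<Longrightarrow> \<not> degenerate_mod (lower 2) (phi t)"
    using \<open>type_B\<close> unfolding type_B_def by blast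
  obtain y0 where y0: "y0 \<in> lower 2" "form x y0 \<noteq> 0"
    using x(2) unfolding center_eq_perp_lower_2 by blast
  define y where "y = smul (1 / form x y0) y0"
  have y: "y \<in> lower 2" "form x y = 1"
    using y0 by (simp_all add: y_def form_simps subspace_scale[OF subspace_lower_2])
  \<comment> \<open>Type B applies to every y + k x: subtracting multiples of x keeps the pairing
    with x nonzero, whereas central elements are orthogonal to x in L^2.\<close>
  have nondeg_y: "s \<in> lower 2" if "\<And>w. phi (y + smul k x) s w = 0" for s k
  proof -
    have "y + smul k x - smul c x \<notin> center" for c
    proof
      assume "y + smul k x - smul c x \<in> center"
      from form_center_lower_2(2)[OF this x(1)] show False
        using y(2) by (simp add: form_simps form_diff form_alternating)
    qed
    moreover have "y + smul k x \<in> lower 2"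
      using x(1) y(1) by (intro subspace_add subspace_scale subspace_lower_2)
    ultimately have "\<not> degenerate_mod (lower 2) (phi (y + smul k x))"
      by (intro nondeg)
    then show ?thesis
      using that unfolding degenerate_mod_def by blast
  qed
  obtain a b u v where ab: "phi x a b = 1" and u: "\<And>w. phi x u w = 0" and v: "\<And>w. phi x v w = 0"
    and indep: "\<And>p q. smul p u + smul q v \<in> lower 2 \<Longrightarrow> p = 0 \<and> q = 0"
    and extend: "\<And>s t w. t \<in> lower 2 \<Longrightarrow> phi t s a = 0 \<Longrightarrow> phi t s b = 0 \<Longrightarrow> phi t s u = 0 \<Longrightarrow>
      phi t s v = 0 \<Longrightarrow> phi t s w = 0"
    using radical_frame[OF dim lower3 x] by metis
  have xu: "phi x w u = 0" "phi x w v = 0" for w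
    using phi_swap(2)[of x w u] phi_swap(2)[of x w v] u v by simp_all
  have neg: "phi y b a = - phi y a b" "phi y u a = - phi y a u" "phi y v a = - phi y a v"
    "phi y u b = - phi y b u" "phi y v b = - phi y b v" "phi y v u = - phi y u v"
    by (rule phi_swap(2))+
  have uv: "phi y u v = 0"
  proof (rule ccontr)
    assume nz: "phi y u v \<noteq> 0"
    \<comment> \<open>\<open>s\<close> spans the radical of the singular member \<open>phi (y + k x)\<close> of the pencil, where \<open>k\<close>
      is the zero of the Pfaffian, an affine function of \<open>k\<close> with leading coefficient \<open>phi y u v\<close>.\<close>
    define s where "s = smul (phi y u v) a - smul (phi y a v) u + smul (phi y a u) v"
    define k where "k = - phi y s b / phi y u v"
    have xs: "phi x s a = 0" "phi x s b = phi y u v" "phi x s u = 0" "phi x s v = 0"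
      by (simp_all add: s_def phi_linear u v xu ab phi_same)
    have ys: "phi y s a = 0" "phi y s u = 0" "phi y s v = 0"
      by (simp_all add: s_def phi_linear phi_same neg algebra_simps)
    have t: "y + smul k x \<in> lower 2"
      using x(1) y(1) by (intro subspace_add subspace_scale subspace_lower_2)
    have "phi (y + smul k x) s w = 0" for w
      by (rule extend[OF t]) (use nz in \<open>simp_all add: phi_linear xs ys k_def\<close>)
    then have "s \<in> lower 2"
      by (rule nondeg_y)
    from L2(1)[OF x(1) this, of b] show False
      using xs(2) nz by simp
  qed
  have y_eq: "y + smul 0 x = y"
    by simp
  \<comment> \<open>A kernel vector (p, q) of the matrix of \<open>phi y\<close> between a, b and u,
    v gives an element p u + q v of the radical of \<open>phi y\<close>, because u, v pair to 0.
    Non-degeneracy puts it into L^2.\<close>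
  have null: "p = 0 \<and> q = 0"
    if "p * phi y a u + q * phi y a v = 0" "p * phi y b u + q * phi y b v = 0" for p q
  proof (rule indep)
    have "phi y (smul p u + smul q v) w = 0" for w
    proof (rule extend[OF y(1)])
      have "phi y (smul p u + smul q v) a = - (p * phi y a u + q * phi y a v)"
        "phi y (smul p u + smul q v) b = - (p * phi y b u + q * phi y b v)"
        by (simp_all add: phi_linear neg)
      then show "phi y (smul p u + smul q v) a = 0" "phi y (smul p u + smul q v) b = 0"
        using that by simp_all
    qed (simp_all add: phi_linear phi_same neg uv)
    then show "smul p u + smul q v \<in> lower 2"
      using nondeg_y[of 0] y_eq by metis
  qed
  define d where "d = phi y a u * phi y b v - phi y a v * phi y b u"
  have d: "d \<noteq> 0"
  proof
    assume "d = 0"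
    \<comment> \<open>For a singular 2 by 2 matrix, the vector orthogonal to a given row lies in the
      kernel; so both rows vanish, and then (1, 0) is in the kernel too.\<close>
    then have "phi y a u = 0" "phi y a v = 0" "phi y b u = 0" "phi y b v = 0"
      using null[of "phi y a v" "- phi y a u"] null[of "phi y b v" "- phi y b u"]
      by (simp_all add: d_def algebra_simps)
    then show False
      using null[of 1 0] by simp
  qed
  \<comment> \<open>Cramer's rule: y4 and y5 are the basis of the span of u, v dual to a, b under
    \<open>phi y\<close>.\<close>
  define y4 where "y4 = smul (phi y b v / d) u - smul (phi y b u / d) v"
  define y5 where "y5 = smul (phi y a u / d) v - smul (phi y a v / d) u"
  \<comment> \<open>Removes \<open>phi y a b\<close>; \<open>phi x\<close> does not notice, since y4
    is in its radical.\<close>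
  define y3 where "y3 = b - smul (phi y a b) y4"
  have 4: "phi y a y4 = 1" "phi y b y4 = 0"
    using d by (simp_all add: y4_def phi_linear divide_simps) (simp_all add: d_def algebra_simps)
  have 5: "phi y a y5 = 0" "phi y b y5 = 1"
    using d by (simp_all add: y5_def phi_linear divide_simps) (simp_all add: d_def algebra_simps)
  have 45: "phi y y4 y5 = 0"
    by (simp add: y4_def y5_def phi_linear phi_same neg uv)
  have x45: "phi x y4 w = 0" "phi x y5 w = 0" "phi x w y4 = 0" for w
    by (simp_all add: y4_def y5_def phi_linear u v xu)
  show ?thesis
  proof (rule that[of x y a y3 y4 y5])
    show "phi x a y3 = 1"
      by (simp add: y3_def phi_linear ab x45)
    show "phi y a y3 = 0" "phi y y3 y4 = 0" "phi y y3 y5 = 1"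
      by (simp_all add: y3_def phi_linear 4 5 45 phi_same)
  qed (use x y x45 4 5 45 in auto)
qed

lemma abelian_frame:
  assumes dim: "dim (UNIV :: 'v set) = 10" "dim center = 4" and lower3: "lower 3 = center" and "type_B"
  obtains x1 y1 y2 y3 y4 y5 where "x1 \<in> lower 2" "y1 \<in> lower 2" "form x1 y1 = 1"
    "phi x1 y2 y3 = 1" "\<And>w. phi x1 y4 w = 0" "\<And>w. phi x1 y5 w = 0"
    "phi y1 y2 y3 = 0" "phi y1 y2 y4 = 1" "phi y1 y2 y5 = 0"
    "phi y1 y3 y4 = 0" "phi y1 y3 y5 = 1" "phi y1 y4 y5 = 0"
    "phi y2 y3 y4 = 0" "phi y2 y3 y5 = 0" "phi y2 y4 y5 = 0" "phi y3 y4 y5 = 0"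
proof -
  obtain x y t2 t3 t4 t5 where *: "x \<in> lower 2" "y \<in> lower 2" "form x y = 1"
    "phi x t2 t3 = 1" "\<And>w. phi x t4 w = 0" "\<And>w. phi x t5 w = 0"
    "phi y t2 t3 = 0" "phi y t2 t4 = 1" "phi y t2 t5 = 0"
    "phi y t3 t4 = 0" "phi y t3 t5 = 1" "phi y t4 t5 = 0"
    using normal_frame[OF assms] by metis
  have swap: "phi t2 y w = - phi y t2 w" "phi t3 y w = - phi y t3 w" "phi t4 y w = - phi y t4 w" for w
    by (rule phi_swap(1))+
  have rotate: "phi t2 t3 y = phi y t2 t3" "phi t2 t4 y = phi y t2 t4" "phi t3 t4 y = phi y t3 t4"
    "phi w y y = 0" for w
    using phi_rotate phi_same(2) by blast+
  have xy: "phi x y w = 0" "phi x w y = 0" for w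
    using phi_lower_2[OF lower3 *(1,2)] by blast+
  \<comment> \<open>Each of the four triples from 2, ..., 5 contains exactly one of the pairs (2,
    4), (3, 5) on which \<open>phi y\<close> is 1. Adding a multiple of y to the vector at the
    remaining index kills that triple; the four triples use four different indices.\<close>
  define y2 where "y2 = t2 - smul (phi t2 t3 t5) y"
  define y3 where "y3 = t3 + smul (phi t2 t3 t4) y"
  define y4 where "y4 = t4 + smul (phi t3 t4 t5) y"
  define y5 where "y5 = t5 - smul (phi t2 t4 t5) y"
  show ?thesis
    by (rule that[of x y y2 y3 y4 y5])
      (simp_all add: y2_def y3_def y4_def y5_def phi_linear phi_same xy * swap rotate)
qed

section \<open>From the normal form of \<open>phi\<close> to a standard basis\<close>

lemma gram_5I:
  assumes "\<And>i j. i \<in> {1, 2, 3, 4, 5} \<Longrightarrow> j \<in> {1, 2, 3, 4, 5} \<Longrightarrow>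
      form (b (X i)) (b (X j)) = 0 \<and> form (b (Y i)) (b (Y j)) = 0 \<and>
      form (b (X i)) (b (Y j)) = (if i = j then 1 else 0)"
  shows "gram 5 b"
proof -
  have "{1..5::nat} = {1, 2, 3, 4, 5}"
    by auto
  then show ?thesis
    unfolding gram_def using assms by (simp only: ball_simps) blast
qed

lemma type_B_has_presentation:
  assumes dim: "dim (UNIV :: 'v set) = 10" "dim center = 4" and lower3: "lower 3 = center" and "type_B"
  shows "\<exists>b. has_presentation 5 P_10_4_3 b"
proof -
  obtain x1 y1 y2 y3 y4 y5 where *: "x1 \<in> lower 2" "y1 \<in> lower 2" and x1y1: "form x1 y1 = 1"
    and phis: "phi x1 y2 y3 = 1" "\<And>w. phi x1 y4 w = 0" "\<And>w. phi x1 y5 w = 0"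
    "phi y1 y2 y3 = 0" "phi y1 y2 y4 = 1" "phi y1 y2 y5 = 0"
    "phi y1 y3 y4 = 0" "phi y1 y3 y5 = 1" "phi y1 y4 y5 = 0"
    "phi y2 y3 y4 = 0" "phi y2 y3 y5 = 0" "phi y2 y4 y5 = 0" "phi y3 y4 y5 = 0"
    using abelian_frame[OF assms] by metis
  have phis': "phi x1 y2 y4 = 0" "phi x1 y2 y5 = 0" "phi x1 y3 y4 = 0" "phi x1 y3 y5 = 0"
    using phi_swap(2)[of x1 y2 y4] phi_swap(2)[of x1 y2 y5] phi_swap(2)[of x1 y3 y4]
      phi_swap(2)[of x1 y3 y5] phis(2,3) by simp_all
  have neg: "phi y1 y3 y2 = 0" "phi y1 y4 y2 = -1" "phi y1 y4 y3 = 0" "phi y1 y5 y2 = 0"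
    "phi y1 y5 y3 = -1" "phi y1 y5 y4 = 0"
    using phi_swap(2)[of y1 y3 y2] phi_swap(2)[of y1 y4 y2] phi_swap(2)[of y1 y4 y3]
      phi_swap(2)[of y1 y5 y2] phi_swap(2)[of y1 y5 y3] phi_swap(2)[of y1 y5 y4] phis by simp_all
  \<comment> \<open>By \<open>phi y1 y2 y4 = 1\<close> and \<open>phi y1 y3 y5 = 1\<close>, the
    products of y1 with y4, y5, y2, y3 are dual to y2, y3, y4, y5 up to sign; the first two need the
    sign.\<close>
  define x2 where "x2 = - (y1 \<cdot> y4)"
  define x3 where "x3 = - (y1 \<cdot> y5)"
  define x4 where "x4 = y1 \<cdot> y2"
  define x5 where "x5 = y1 \<cdot> y3"
  have center: "x2 \<in> center" "x3 \<in> center" "x4 \<in> center" "x5 \<in> center"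
    unfolding x2_def x3_def x4_def x5_def using mul_lower_2_in_lower_3[OF *(2)] lower3
    by (simp_all add: subspace_neg[OF subspace_center])
  have xL: "x2 \<in> lower 2" "x3 \<in> lower 2" "x4 \<in> lower 2" "x5 \<in> lower 2"
    unfolding x2_def x3_def x4_def x5_def using mul_in_lower_2
    by (simp_all add: subspace_neg[OF subspace_lower_2])
  have xx: "form c d = 0" "form d c = 0" if "c \<in> {x2, x3, x4, x5}" "d \<in> {x1, y1, x2, x3, x4, x5}" for c d
    using that center xL * form_center_lower_2 by auto
  have xy: "form x2 y2 = 1" "form x2 y3 = 0" "form x2 y4 = 0" "form x2 y5 = 0"
    "form x3 y2 = 0" "form x3 y3 = 1" "form x3 y4 = 0" "form x3 y5 = 0"
    "form x4 y2 = 0" "form x4 y3 = 0" "form x4 y4 = 1" "form x4 y5 = 0"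
    "form x5 y2 = 0" "form x5 y3 = 0" "form x5 y4 = 0" "form x5 y5 = 1"
    by (simp_all add: x2_def x3_def x4_def x5_def form_minus phi_def[symmetric] phis neg phi_same)
  have yx: "form y x2 = - form x2 y" "form y x3 = - form x3 y" "form y x4 = - form x4 y" "form y x5 = - form x5 y"
    if "y \<in> {y2, y3, y4, y5}" for y
    by (rule form_skew)+
  have skew: "form y x1 = - form x1 y" "form y y1 = - form y1 y" if "y \<in> {y2, y3, y4, y5}" for y
    by (rule form_skew)+
  have skew': "form y3 y2 = - form y2 y3" "form y4 y2 = - form y2 y4" "form y5 y2 = - form y2 y5"
    "form y4 y3 = - form y3 y4" "form y5 y3 = - form y3 y5" "form y5 y4 = - form y4 y5"
    by (rule form_skew)+
  \<comment> \<open>The central x2, ..., x5 are orthogonal to L^2, which contains x1, y1 and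
    themselves, so each correction removes one pairing and creates none. For y_i only x_j with j > i
    occur, which removes (y_i, y_j) once and not twice.\<close>
  define X1 where "X1 = x1 - (smul (form x1 y2) x2 + smul (form x1 y3) x3 + smul (form x1 y4) x4 + smul (form x1 y5) x5)"
  define Y1 where "Y1 = y1 - (smul (form y1 y2) x2 + smul (form y1 y3) x3 + smul (form y1 y4) x4 + smul (form y1 y5) x5)"
  define Y2 where "Y2 = y2 - (smul (form y2 y3) x3 + smul (form y2 y4) x4 + smul (form y2 y5) x5)"
  define Y3 where "Y3 = y3 - (smul (form y3 y4) x4 + smul (form y3 y5) x5)"
  define Y4 where "Y4 = y4 - smul (form y4 y5) x5"
  note defs = X1_def Y1_def Y2_def Y3_def Y4_def
  \<comment> \<open>Labels outside 1, ..., 5, including 0, fall through to x5 and y5.\<close>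
  define b where "b p = (case p of
      X i \<Rightarrow> if i = 1 then X1 else if i = 2 then x2 else if i = 3 then x3 else if i = 4 then x4 else x5
    | Y i \<Rightarrow> if i = 1 then Y1 else if i = 2 then Y2 else if i = 3 then Y3 else if i = 4 then Y4 else y5)" for p
  have b: "b (X 1) = X1" "b (X 2) = x2" "b (X 3) = x3" "b (X 4) = x4" "b (X 5) = x5"
    "b (Y 1) = Y1" "b (Y 2) = Y2" "b (Y 3) = Y3" "b (Y 4) = Y4" "b (Y 5) = y5"
    by (simp_all add: b_def)
  have "gram 5 b"
  proof (rule gram_5I)
    fix i j :: nat
    assume "i \<in> {1, 2, 3, 4, 5}" "j \<in> {1, 2, 3, 4, 5}"
    then show "form (b (X i)) (b (X j)) = 0 \<and> form (b (Y i)) (b (Y j)) = 0 \<and>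
      form (b (X i)) (b (Y j)) = (if i = j then 1 else 0)"
      by (elim insertE emptyE; simp only: b)
        (simp_all add: defs form_simps form_diff xx xy yx skew skew' x1y1 form_alternating)
  qed
  then have "standard_basis 5 b"
    by (rule standard_basisI) (simp add: dim)
  then have "has_presentation 5 P_10_4_3 b"
    by (rule has_presentationI; unfold b)
      (simp_all add: center defs phi_linear phis phis' phi_center[OF center(1)] phi_center[OF center(2)]
        phi_center[OF center(3)] phi_center[OF center(4)] phi_lower_2[OF lower3 *])
  then show ?thesis
    by blast
qed

end

section \<open>Uniqueness up to isomorphism\<close>

lemma has_presentation_isomorphic:
  fixes smul :: "'f::field \<Rightarrow> 'v::ab_group_add \<Rightarrow> 'v" and smul' :: "'f \<Rightarrow> 'w::ab_group_add \<Rightarrow> 'w"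
  assumes L: "symplectic_alternating_algebra smul form mul"
    and L': "symplectic_alternating_algebra smul' form' mul'"
    and P: "symplectic_alternating_algebra.has_presentation smul form mul 5 P_10_4_3 b"
    and P': "symplectic_alternating_algebra.has_presentation smul' form' mul' 5 P_10_4_3 b'"
  shows "saa_isomorphic smul form mul smul' form' mul'"
proof -
  interpret L: symplectic_alternating_algebra smul form mul by (rule L)
  interpret L': symplectic_alternating_algebra smul' form' mul' by (rule L')
  interpret vector_space_pair smul smul' ..
  let ?I = "basis_indices 5"
  have basis: "L.standard_basis 5 b" and basis': "L'.standard_basis 5 b'"
    using P P' L.has_presentation_iff L'.has_presentation_iff by blast+
  note gram' = L'.standard_basis_gram[OF basis']
  \<comment> \<open>The map identifying equal coordinates; g is its inverse.\<close>
  define f where "f v = (\<Sum>p\<in>?I. smul' (L.coord b p v) (b' p))" for v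
  define g where "g w = (\<Sum>p\<in>?I. smul (L'.coord b' p w) (b p))" for w
  have coord_f: "L'.coord b' p (f v) = L.coord b p v" if "p \<in> ?I" for p v
    unfolding f_def using L'.coord_sum_basis[OF gram' that] .
  have coord_g: "L.coord b p (g w) = L'.coord b' p w" if "p \<in> ?I" for p w
    unfolding g_def using L.coord_sum_basis[OF L.standard_basis_gram[OF basis] that] .
  have mem: "X 1 \<in> ?I" "X 2 \<in> ?I" "X 3 \<in> ?I" "X 4 \<in> ?I" "X 5 \<in> ?I"
    "Y 1 \<in> ?I" "Y 2 \<in> ?I" "Y 3 \<in> ?I" "Y 4 \<in> ?I" "Y 5 \<in> ?I"
    by (simp_all add: basis_indices_5)
  have linear: "Vector_Spaces.linear smul smul' f"
    by unfold_locales (simp_all add: f_def L.coord_simps L'.scale_left_distrib sum.distrib L'.scale_sum_right)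
  have "inj f"
    using coord_f L.coord_eqI[OF basis] by (metis injI)
  have f_g: "f (g w) = w" for w
    by (rule L'.coord_eqI[OF basis']) (simp add: coord_f coord_g)
  have "bij f"
    using \<open>inj f\<close> f_g by (metis bij_def surjI)
  have phi: "L'.phi (f u) (f v) (f w) = L.phi u v w" for u v w
    unfolding L.has_presentation_phi[OF P] L'.has_presentation_phi[OF P'] det3_def
    by (simp only: coord_f[OF mem(1)] coord_f[OF mem(6)] coord_f[OF mem(7)] coord_f[OF mem(8)]
        coord_f[OF mem(9)] coord_f[OF mem(10)])
  have form: "form' (f u) (f v) = form u v" for u v
  proof -
    have *: "form' (f u) (b' q) = form u (b q)" if "q \<in> ?I" for q
      using that coord_f unfolding L.form_basis_right L'.form_basis_right
      by (auto simp: basis_indices_def split: basis_index.split)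
    have "form' (f u) (f v) = (\<Sum>q\<in>?I. L.coord b q v * form' (f u) (b' q))"
      unfolding f_def[of v] by (simp add: L'.form_sum L'.form_simps)
    also have "\<dots> = (\<Sum>q\<in>?I. L.coord b q v * form u (b q))"
      by (intro sum.cong) (simp_all add: *)
    also have "\<dots> = form u (\<Sum>q\<in>?I. smul (L.coord b q v) (b q))"
      by (simp add: L.form_sum L.form_simps)
    also have "(\<Sum>q\<in>?I. smul (L.coord b q v) (b q)) = v"
      by (rule L.coord_expansion[OF basis, symmetric])
    finally show ?thesis .
  qed
  \<comment> \<open>By non-degeneracy it suffices to pair with all vectors; surjectivity writes each
    as an image under f, where preservation of the form and of \<open>phi\<close> applies.\<close>
  have "f (mul u v) = mul' (f u) (f v)" for u v
  proof (rule L'.form_eqI)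
    fix y
    have "form' (f (mul u v)) (f (g y)) = form' (mul' (f u) (f v)) (f (g y))"
      using phi[of u v "g y"] by (simp add: form L.phi_def L'.phi_def)
    then show "form' (f (mul u v)) y = form' (mul' (f u) (f v)) y"
      by (simp only: f_g)
  qed
  with linear \<open>bij f\<close> form show ?thesis
    unfolding saa_isomorphic_def by blast
qed

lemma (in symplectic_alternating_algebra) type_B_algebra_iff_presentation:
  "type_B_algebra_10_4_3 smul form (\<cdot>) \<longleftrightarrow> (\<exists>b. has_presentation 5 P_10_4_3 b)"
  unfolding type_B_algebra_10_4_3_def
  using has_presentation_type_B type_B_has_presentation symplectic_alternating_algebra_axioms by blast

section \<open>A model on the coordinate space of dimension 10\<close>

lemma has_presentation_exists:
  "\<exists>(form\<^sub>0 :: 'f::field ^ 10 \<Rightarrow> 'f ^ 10 \<Rightarrow> 'f) mul\<^sub>0 b.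
    symplectic_alternating_algebra (*s) form\<^sub>0 mul\<^sub>0 \<and>
    symplectic_alternating_algebra.has_presentation (*s) form\<^sub>0 mul\<^sub>0 5 P_10_4_3 b"
proof -
  have "card {2..11::nat} = card (UNIV :: 10 set)"
    by simp
  then obtain k :: "nat \<Rightarrow> 10" where "bij_betw k {2..11} UNIV"
    using finite_same_card_bij[of "{2..11::nat}" "UNIV :: 10 set"] by auto
  then have inj: "inj_on k {2..11}" and surj: "k ` {2..11} = UNIV"
    by (auto simp: bij_betw_def)
  have k_eq: "k i = k j \<longleftrightarrow> i = j" if "i \<in> {2..11}" "j \<in> {2..11}" for i j
    using inj that by (auto dest: inj_onD)
  define e :: "nat \<Rightarrow> 'f ^ 10" where "e i = axis (k i) 1" for i
  have e_nth: "e j $ k i = (if i = j then 1 else 0)" if "i \<in> {2..11}" "j \<in> {2..11}" for i j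
    using that by (simp add: e_def axis_def k_eq)
  \<comment> \<open>The standard symplectic form, with label i paired to label i + 5.\<close>
  define B :: "'f ^ 10 \<Rightarrow> 'f ^ 10 \<Rightarrow> 'f" where "B v w =
    v $ k 2 * w $ k 7 - v $ k 7 * w $ k 2 + (v $ k 3 * w $ k 8 - v $ k 8 * w $ k 3) +
    (v $ k 4 * w $ k 9 - v $ k 9 * w $ k 4) + (v $ k 5 * w $ k 10 - v $ k 10 * w $ k 5) +
    (v $ k 6 * w $ k 11 - v $ k 11 * w $ k 6)" for v w
  define m :: "nat \<Rightarrow> nat \<Rightarrow> 'f ^ 10 \<Rightarrow> 'f ^ 10 \<Rightarrow> 'f"
    where "m i j v w = v $ k i * w $ k j - v $ k j * w $ k i" for i j v w
  \<comment> \<open>\<open>e 2, \<dots>, e 6\<close> are $x_1, \dots, x_5$ and \<open>e 7, \<dots>, e 11\<close> are $y_1, \dots, y_5$;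
    the coefficients are read off from $(vw, z)$ as the sum of the three determinants of the
    coordinates listed in the presentation.\<close>
  define M where "M v w =
    (m 8 10 v w + m 9 11 v w) *s e 2 + (m 9 2 v w + m 10 7 v w) *s e 3 +
    (m 2 8 v w + m 11 7 v w) *s e 4 + m 7 8 v w *s e 5 + m 7 9 v w *s e 6 + m 9 8 v w *s e 7" for v w
  have M_nth: "M v w $ k 2 = m 8 10 v w + m 9 11 v w" "M v w $ k 3 = m 9 2 v w + m 10 7 v w"
    "M v w $ k 4 = m 2 8 v w + m 11 7 v w" "M v w $ k 5 = m 7 8 v w" "M v w $ k 6 = m 7 9 v w"
    "M v w $ k 7 = m 9 8 v w" "M v w $ k 8 = 0" "M v w $ k 9 = 0" "M v w $ k 10 = 0" "M v w $ k 11 = 0" for v w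
    by (simp_all add: M_def e_nth)
  have B_e: "B v (e 2) = - (v $ k 7)" "B v (e 3) = - (v $ k 8)" "B v (e 4) = - (v $ k 9)"
    "B v (e 5) = - (v $ k 10)" "B v (e 6) = - (v $ k 11)" "B v (e 7) = v $ k 2" "B v (e 8) = v $ k 3"
    "B v (e 9) = v $ k 4" "B v (e 10) = v $ k 5" "B v (e 11) = v $ k 6" for v
    by (simp_all add: B_def e_nth)
  have range: "{2..11} = {2, 3, 4, 5, 6, 7, 8, 9, 10, 11::nat}"
    by (auto, arith)
  interpret L: symplectic_alternating_algebra "(*s)" B M
  proof
    show "\<exists>S. finite S \<and> vec.span S = (UNIV :: ('f ^ 10) set)"
      using vec.finite_Basis vec.span_Basis by blast
    show "B x x = 0" for x
      by (simp add: B_def algebra_simps)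
    show "x = 0" if "\<forall>y. B x y = 0" for x
    proof -
      have "x $ k i = 0" if "i \<in> {2..11}" for i
        using that \<open>\<forall>y. B x y = 0\<close> B_e[of x] unfolding range by (elim insertE emptyE) simp_all
      then show ?thesis
        using surj by (metis imageE iso_tuple_UNIV_I vec_eq_iff zero_index)
    qed
    show "M x x = 0" for x
      by (simp add: M_def m_def)
    show "B (M x y) z = B (M y z) x" for x y z
      by (simp add: B_def M_nth m_def algebra_simps)
  qed (simp_all add: B_def M_def m_def algebra_simps vec.scale_left_distrib vec.scale_left_diff_distrib)
  define b where "b p = (case p of X i \<Rightarrow> e (i + 1) | Y i \<Rightarrow> e (i + 6))" for p
  have b: "b (X 1) = e 2" "b (X 2) = e 3" "b (X 3) = e 4" "b (X 4) = e 5" "b (X 5) = e 6"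
    "b (Y 1) = e 7" "b (Y 2) = e 8" "b (Y 3) = e 9" "b (Y 4) = e 10" "b (Y 5) = e 11"
    by (simp_all add: b_def del: One_nat_def)
  have "L.gram 5 b"
  proof (rule L.gram_5I)
    fix i j :: nat
    assume "i \<in> {1, 2, 3, 4, 5}" "j \<in> {1, 2, 3, 4, 5}"
    then show "B (b (X i)) (b (X j)) = 0 \<and> B (b (Y i)) (b (Y j)) = 0 \<and>
        B (b (X i)) (b (Y j)) = (if i = j then 1 else 0)"
      by (elim insertE emptyE; simp only: b) (simp_all add: B_e e_nth)
  qed
  then have "L.standard_basis 5 b"
    by (rule L.standard_basisI) (simp add: card_cart_basis)
  then have "L.has_presentation 5 P_10_4_3 b"
    by (rule L.has_presentationI; unfold b)
      (simp_all add: L.center_def L.phi_def B_def M_nth m_def e_nth M_def)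
  with L.symplectic_alternating_algebra_axioms show ?thesis
    by blast
qed

theorem proposition2p3:
  fixes smul :: "'f::field \<Rightarrow> 'v::ab_group_add \<Rightarrow> 'v"
    and form :: "'v \<Rightarrow> 'v \<Rightarrow> 'f"
    and mul :: "'v \<Rightarrow> 'v \<Rightarrow> 'v"
    and smul' :: "'f \<Rightarrow> 'w::ab_group_add \<Rightarrow> 'w"
    and form' :: "'w \<Rightarrow> 'w \<Rightarrow> 'f"
    and mul' :: "'w \<Rightarrow> 'w \<Rightarrow> 'w"
  shows
    "(\<exists>(form\<^sub>0 :: 'f ^ 10 \<Rightarrow> 'f ^ 10 \<Rightarrow> 'f) mul\<^sub>0. type_B_algebra_10_4_3 (*s) form\<^sub>0 mul\<^sub>0) \<and>
     (type_B_algebra_10_4_3 smul form mul \<and> type_B_algebra_10_4_3 smul' form' mul' \<longrightarrow>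
       saa_isomorphic smul form mul smul' form' mul') \<and>
     (symplectic_alternating_algebra smul form mul \<longrightarrow>
       (type_B_algebra_10_4_3 smul form mul \<longleftrightarrow>
         (\<exists>b. symplectic_alternating_algebra.has_presentation smul form mul 5 P_10_4_3 b)))"
proof (intro conjI impI)
  note iff = symplectic_alternating_algebra.type_B_algebra_iff_presentation
  show "\<exists>(form\<^sub>0 :: 'f ^ 10 \<Rightarrow> 'f ^ 10 \<Rightarrow> 'f) mul\<^sub>0. type_B_algebra_10_4_3 (*s) form\<^sub>0 mul\<^sub>0"
    using has_presentation_exists[where 'f = 'f] iff by metis
  show "saa_isomorphic smul form mul smul' form' mul'"
    if *: "type_B_algebra_10_4_3 smul form mul \<and> type_B_algebra_10_4_3 smul' form' mul'"
  proof -
    have L: "symplectic_alternating_algebra smul form mul" "symplectic_alternating_algebra smul' form' mul'"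
      using * unfolding type_B_algebra_10_4_3_def by blast+
    then obtain b b' where "symplectic_alternating_algebra.has_presentation smul form mul 5 P_10_4_3 b"
        "symplectic_alternating_algebra.has_presentation smul' form' mul' 5 P_10_4_3 b'"
      using * iff by metis
    with L show ?thesis
      by (rule has_presentation_isomorphic)
  qed
  show "type_B_algebra_10_4_3 smul form mul \<longleftrightarrow>
      (\<exists>b. symplectic_alternating_algebra.has_presentation smul form mul 5 P_10_4_3 b)"
    if "symplectic_alternating_algebra smul form mul"
    using that by (rule iff)
qed

end
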